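(* Let $T=\{\mu_1^{(t_1)},\ldots,\mu_r^{(t_r)}\},\ldots,L=\{\mu_1'^{(l_1)},\ldots,\mu_m'^{(l_m)}\}$ be finitely many multisets of umbral monomials, the monomials in different multisets being uncorrelated (marked by uncorrelation labels such as primes), and let $n>|T|+\cdots+|L|$ be an integer. Then $$k_{t_1\ldots t_r,\ldots,l_1\ldots l_m}\simeq\sum_{(\pi\in\Pi_{|T|},\ldots,\tilde\pi\in\Pi_{|L|})}\frac{(\chi\boldsymbol{.}\chi)^{|\pi|}\cdots(\chi'\boldsymbol{.}\chi')^{|\tilde\pi|}}{(n)_{|\pi|+\cdots+|\tilde\pi|}}\sum_{\tau\in\Pi_{|\pi|+\cdots+|\tilde\pi|}}(\chi\boldsymbol{.}\chi)^{\boldsymbol{.}\tau}\,(n\boldsymbol{.}p)_{S_\tau},$$ where $S_\tau$ is the subdivision of the multiset obtained by the disjoint union of $T,\ldots,L$ with no uncorrelation labels, corresponding to the partition $\tau$ of the set built with the blocks of $\{\pi,\ldots,\tilde\pi\}$.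
   Context: Umbral calculus: $K$ is a field of characteristic zero, $A$ a set of symbols called umbrae, $E:K[A]\to K$ a linear functional with $E[1]=1$ and $E[\alpha^i\beta^j\cdots\gamma^k]=E[\alpha^i]E[\beta^j]\cdots E[\gamma^k]$ for distinct umbrae. For umbral polynomials, $p\simeq q$ means $E[p]=E[q]$; $p,q$ are uncorrelated if no umbra occurs in both; $p\equiv q$ (similar) means $E[p^j]=E[q^j]$ for all $j\ge0$. The alphabet is saturated: for every sequence $1,a_1,a_2,\dots$ in $K$ there are infinitely many umbrae with these moments, and auxiliary umbrae are treated as elements of $A$. $(x)_m=x(x-1)\cdots(x-m+1)$; $\Pi_k$ is the set of partitions of $[k]=\{1,\dots,k\}$ (or of any $k$-element set); $|\pi|$ is the number of blocks of $\pi$. In a multiset, $\mu^{(f)}$ means $\mu$ with multiplicity $f$; $|M|$ is the sum of multiplicities. Dot products: for an umbral polynomial $p$, $n\boldsymbol{.}p$ denotes $p_1+\cdots+p_n$, where $p_j$ is obtained from $p$ by replacing each umbra by its $j$th copy (copies being similar to the original and mutually uncorrelated); the same copies are used for all $p$. The singleton umbra $\chi$ has $E[\chi]=1$, $E[\chi^j]=0$ for $j\ge2$; it does not occur in the monomials of $T,\ldots,L$. One has $E[(\chi)_m]=(-1)^{m-1}(m-1)!$, and $\chi\boldsymbol{.}\chi$ is an umbra with $E[(\chi\boldsymbol{.}\chi)^m]=(-1)^{m-1}(m-1)!$ for $m\ge1$. For a multiset $M=\{\mu_i^{(f(\mu_i))}\}$ of umbral monomials, $(n\boldsymbol{.}\mu)_M=\prod_i(n\boldsymbol{.}\mu_i)^{f(\mu_i)}$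 and $(\chi\boldsymbol{.}\mu)_M=\prod_i(\chi\boldsymbol{.}\mu_i)^{f(\mu_i)}$. The evaluation of the latter (the multivariate cumulant of $M$) is given by symbolic substitution: $q_M(n)=E[(n\boldsymbol{.}\mu)_M]$ is a polynomial in $n$, and $E[(\chi\boldsymbol{.}\mu)_M]=E[q_M(\chi)]$. The multivariate polykay is characterized umbrally by $k_{t_1\ldots t_r,\ldots,l_1\ldots l_m}\simeq(\chi\boldsymbol{.}\mu)_T\cdots(\chi'\boldsymbol{.}\mu')_L$, with $\chi,\ldots,\chi'$ uncorrelated singleton umbrae and the monomials of $T,\ldots,L$ uncorrelated from one multiset to another; i.e. $E[k_{t_1\ldots t_r,\ldots,l_1\ldots l_m}]=E[(\chi\boldsymbol{.}\mu)_T]\cdots E[(\chi'\boldsymbol{.}\mu')_L]$. Uncorrelation labels: monomials of different multisets may be uncorrelated copies of (possibly the same or mutually correlated) original monomials; e.g. $\mu_1'$ is a copy of $\mu_1$. "With no uncorrelation labels" means replacing each monomial of $T,\ldots,L$ by the original monomial it is a copy of ($\mu_1'$ by $\mu_1$, etc.). For a partition $\tau$, $(\chi\boldsymbol{.}\chi)^{\boldsymbol{.}\tau}$ is a product, over the blocks $C$ of $\tau$, of $|C|$th powers of uncorrelated umbrae similar to $\chi\boldsymbol{.}\chi$, so $E[(\chi\boldsymbol{.}\chi)^{\boldsymbol{.}\tau}]=\prod_{C\in\tau}(-1)^{|C|-1}(|C|-1)!$. The factors $(\chi\boldsymbol{.}\chi)^{|\pi|},\ldots,(\chi'\boldsymbol{.}\chi')^{|\tilde\pi|}$,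 $(\chi\boldsymbol{.}\chi)^{\boldsymbol{.}\tau}$ and $(n\boldsymbol{.}p)_{S_\tau}$ are mutually uncorrelated. Subdivisions: let $J$ be the disjoint union of index sets of sizes $|T|,\ldots,|L|$ and let $s$ map $J$ to the unlabeled monomials, so that the index set of each multiset hits each of its elements as often as its multiplicity; $\pi,\ldots,\tilde\pi$ are partitions of the respective index sets. If $\tau$ is a partition of the set of all blocks of $\pi,\ldots,\tilde\pi$, then $S_\tau$ is the multiset of the submultisets $\{s(j):j\in\bigcup_{B\in C}B\}$, $C\in\tau$, and $(n\boldsymbol{.}p)_{S_\tau}=\prod_{C\in\tau}n\boldsymbol{.}\bigl(\prod_{B\in C}\prod_{j\in B}s(j)\bigr)$. *)

theory Defs
  imports
    "HOL-Library.Poly_Mapping"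
    "HOL-Library.Multiset"
    "HOL-Library.FuncSet"
    "HOL-Library.Disjoint_Sets"
    "HOL-Computational_Algebra.Polynomial"
begin

text \<open>
  A monomial is its exponent vector, and an umbral polynomial is an element of the polynomial
  ring over \<^typ>\<open>'k\<close> whose indeterminates are the umbrae, i.e. the elements of \<^typ>\<open>'a\<close>.
\<close>

type_synonym 'a umonom = "'a \<Rightarrow>\<^sub>0 nat"
type_synonym ('a, 'k) upoly = "'a umonom \<Rightarrow>\<^sub>0 'k"

definition cst :: "'k::field_char_0 \<Rightarrow> ('a, 'k) upoly" where
  "cst c = Poly_Mapping.single 0 c"

definition mono_poly :: "'a umonom \<Rightarrow> ('a, 'k::field_char_0) upoly" where
  "mono_poly m = Poly_Mapping.single m 1"

definition umb :: "'a \<Rightarrow> ('a, 'k::field_char_0) upoly" where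
  "umb x = mono_poly (Poly_Mapping.single x 1)"

definition umbrae :: "('a, 'k::field_char_0) upoly \<Rightarrow> 'a set" where
  "umbrae p = (\<Union>m\<in>Poly_Mapping.keys p. Poly_Mapping.keys m)"

definition uncorrelated :: "('a, 'k::field_char_0) upoly \<Rightarrow> ('a, 'k) upoly \<Rightarrow> bool" where
  "uncorrelated p q \<longleftrightarrow> umbrae p \<inter> umbrae q = {}"

definition similar ::
    "(('a, 'k::field_char_0) upoly \<Rightarrow> 'k) \<Rightarrow> ('a, 'k) upoly \<Rightarrow> ('a, 'k) upoly \<Rightarrow> bool" where
  "similar E p q \<longleftrightarrow> (\<forall>j::nat. E (p ^ j) = E (q ^ j))"

definition rename_mono :: "('a \<Rightarrow> 'a) \<Rightarrow> 'a umonom \<Rightarrow> 'a umonom" where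
  "rename_mono f m =
     (\<Sum>x\<in>Poly_Mapping.keys m. Poly_Mapping.single (f x) (Poly_Mapping.lookup m x))"

definition rename_poly :: "('a \<Rightarrow> 'a) \<Rightarrow> ('a, 'k::field_char_0) upoly \<Rightarrow> ('a, 'k) upoly" where
  "rename_poly f p =
     (\<Sum>m\<in>Poly_Mapping.keys p. Poly_Mapping.single (rename_mono f m) (Poly_Mapping.lookup p m))"

text \<open>
  \<open>copy j x\<close> is the \<open>j\<close>th copy of the umbra \<open>x\<close>. The copies are themselves elements of the
  (saturated) alphabet, and no two of them, for whatever umbrae and indices, coincide.
\<close>

locale umbral_calculus =
  fixes E :: "('a, 'k::field_char_0) upoly \<Rightarrow> 'k"
    and copy :: "nat \<Rightarrow> 'a \<Rightarrow> 'a"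
  assumes E_add: "E (p + q) = E p + E q"
    and E_scale: "E (cst c * p) = c * E p"
    and E_one: "E 1 = 1"
    and E_mono: "E (mono_poly m) =
          (\<Prod>x\<in>Poly_Mapping.keys m. E (umb x ^ Poly_Mapping.lookup m x))"
    and saturated: "a 0 = 1 \<Longrightarrow> infinite {x. \<forall>j. E (umb x ^ j) = a j}"
    and copy_similar: "similar E (umb (copy j x)) (umb x)"
    and copy_distinct: "inj (\<lambda>(j, x). copy j x)"

definition falling :: "'k::field_char_0 \<Rightarrow> nat \<Rightarrow> 'k" where
  "falling x m = (\<Prod>i<m. x - of_nat i)"

definition dot :: "(nat \<Rightarrow> 'a \<Rightarrow> 'a) \<Rightarrow> nat \<Rightarrow> ('a, 'k::field_char_0) upoly \<Rightarrow> ('a, 'k) upoly" where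
  "dot copy n p = (\<Sum>j=1..n. rename_poly (copy j) p)"

definition dot_mset ::
    "(nat \<Rightarrow> 'a \<Rightarrow> 'a) \<Rightarrow> nat \<Rightarrow> 'a umonom multiset \<Rightarrow> ('a, 'k::field_char_0) upoly" where
  "dot_mset copy n M = (\<Prod>\<mu>\<in>set_mset M. dot copy n (mono_poly \<mu>) ^ count M \<mu>)"

text \<open>
  \<open>E (dot_mset copy n M)\<close> is a polynomial function of \<open>n\<close>; as \<^typ>\<open>'k\<close> has characteristic zero,
  the polynomial is determined by its values at the natural numbers.
\<close>

definition dot_moment_poly ::
    "(('a, 'k::field_char_0) upoly \<Rightarrow> 'k) \<Rightarrow> (nat \<Rightarrow> 'a \<Rightarrow> 'a) \<Rightarrow> 'a umonom multiset \<Rightarrow> 'k poly" where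
  "dot_moment_poly E copy M = (THE q. \<forall>n. poly q (of_nat n) = E (dot_mset copy n M))"

definition singleton_umbra :: "(('a, 'k::field_char_0) upoly \<Rightarrow> 'k) \<Rightarrow> 'a \<Rightarrow> bool" where
  "singleton_umbra E c \<longleftrightarrow> E (umb c) = 1 \<and> (\<forall>j\<ge>2. E (umb c ^ j) = 0)"

text \<open>The umbra \<open>\<chi>.\<chi>\<close>, whose moments are the factorial moments of the singleton umbra \<open>\<chi>\<close>.\<close>

definition chi_dot_chi_umbra :: "(('a, 'k::field_char_0) upoly \<Rightarrow> 'k) \<Rightarrow> 'a \<Rightarrow> bool" where
  "chi_dot_chi_umbra E x \<longleftrightarrow> (\<forall>m\<ge>1. E (umb x ^ m) = (- 1) ^ (m - 1) * fact (m - 1))"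

text \<open>
  The evaluation of \<open>(\<chi>.\<mu>)\<^sub>M\<close>: the singleton umbra \<open>c\<close> is substituted for the integer \<open>n\<close>
  in the polynomial \<open>E (dot_mset copy n M)\<close>, and the result is evaluated.
\<close>

definition cumulant ::
    "(('a, 'k::field_char_0) upoly \<Rightarrow> 'k) \<Rightarrow> (nat \<Rightarrow> 'a \<Rightarrow> 'a) \<Rightarrow> 'a \<Rightarrow> 'a umonom multiset \<Rightarrow> 'k" where
  "cumulant E copy c M = E (poly (map_poly cst (dot_moment_poly E copy M)) (umb c))"

definition is_polykay ::
    "(('a, 'k::field_char_0) upoly \<Rightarrow> 'k) \<Rightarrow> (nat \<Rightarrow> 'a \<Rightarrow> 'a) \<Rightarrow> nat \<Rightarrow> (nat \<Rightarrow> 'a) \<Rightarrow>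
      (nat \<Rightarrow> 'a umonom multiset) \<Rightarrow> ('a, 'k) upoly \<Rightarrow> bool" where
  "is_polykay E copy r chi T k \<longleftrightarrow> E k = (\<Prod>i<r. cumulant E copy (chi i) (T i))"

definition mset_umbrae :: "'a umonom multiset \<Rightarrow> 'a set" where
  "mset_umbrae M = (\<Union>\<mu>\<in>set_mset M. Poly_Mapping.keys \<mu>)"

text \<open>
  \<open>T\<close> is \<open>U\<close> with an uncorrelation label attached: each umbra of \<open>U\<close> is replaced by a similar
  one, distinct umbrae by distinct ones. Removing the label turns \<open>T\<close> back into \<open>U\<close>. The
  case \<open>T = U\<close> (no label) is included.
\<close>

definition labelled_copy ::
    "(('a, 'k::field_char_0) upoly \<Rightarrow> 'k) \<Rightarrow> 'a umonom multiset \<Rightarrow> 'a umonom multiset \<Rightarrow> bool" where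
  "labelled_copy E U T \<longleftrightarrow>
     (\<exists>f. inj_on f (mset_umbrae U) \<and> (\<forall>x\<in>mset_umbrae U. similar E (umb (f x)) (umb x)) \<and>
          T = image_mset (rename_mono f) U)"

text \<open>
  The subdivision \<open>S\<^sub>\<tau>\<close>. An element \<open>C\<close> of \<open>\<tau>\<close> is a set of blocks \<open>B\<close>, and these are sets of
  indices \<open>j\<close>; so \<open>\<Union>C\<close> is the set of all indices occurring in the blocks in \<open>C\<close>.
\<close>

definition subdivision :: "('j \<Rightarrow> 'a umonom) \<Rightarrow> 'j set set set \<Rightarrow> 'a umonom multiset multiset" where
  "subdivision s \<tau> = image_mset (\<lambda>C. image_mset s (mset_set (\<Union>C))) (mset_set \<tau>)"

definition dot_subdiv ::
    "(nat \<Rightarrow> 'a \<Rightarrow> 'a) \<Rightarrow> nat \<Rightarrow> 'a umonom multiset multiset \<Rightarrow> ('a, 'k::field_char_0) upoly" where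
  "dot_subdiv copy n S = (\<Prod>M\<in>#S. dot copy n (\<Prod>\<mu>\<in>#M. mono_poly \<mu>))"

lemma dot_subdiv_subdivision:
  fixes copy :: "nat \<Rightarrow> 'a \<Rightarrow> 'a" and s :: "'j \<Rightarrow> 'a umonom"
  assumes "finite X" and P: "partition_on X P" and Q: "partition_on P \<tau>"
  shows "dot_subdiv copy n (subdivision s \<tau>) =
    (\<Prod>C\<in>\<tau>. dot copy n (\<Prod>B\<in>C. \<Prod>j\<in>B. mono_poly (s j)) :: ('a, 'k::field_char_0) upoly)"
proof -
  have "(\<Prod>\<mu>\<in>#image_mset s (mset_set (\<Union>C)). mono_poly \<mu>) =
      (\<Prod>B\<in>C. \<Prod>j\<in>B. mono_poly (s j) :: ('a, 'k) upoly)" if "C \<in> \<tau>" for C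
  proof -
    have C: "C \<subseteq> P"
      using Q that by (auto simp: partition_on_def)
    have "finite B" if "B \<in> C" for B
      using C P that \<open>finite X\<close> by (auto simp: partition_on_def intro: finite_subset)
    moreover have "\<forall>A\<in>C. \<forall>B\<in>C. A \<noteq> B \<longrightarrow> A \<inter> B = {}"
      using C P unfolding partition_on_def pairwise_def disjnt_def by (meson subsetD)
    ultimately have "(\<Prod>j\<in>\<Union>C. mono_poly (s j)) =
        (\<Prod>B\<in>C. \<Prod>j\<in>B. mono_poly (s j) :: ('a, 'k) upoly)"
      by (subst prod.Union_disjoint) (auto simp: o_def)
    thus ?thesis
      by (simp add: image_mset.compositionality o_def flip: prod_unfold_prod_mset)
  qed
  thus ?thesis
    unfolding dot_subdiv_def subdivision_def
    by (simp add: image_mset.compositionality o_def flip: prod_unfold_prod_mset cong: prod.cong)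
qed

text \<open>
  \<open>(\<chi>.\<chi>)\<^sup>.\<^sup>\<tau>\<close>, where \<open>om C\<close> is the umbra similar to \<open>\<chi>.\<chi>\<close> that is used for the block \<open>C\<close>.
\<close>

definition dot_power :: "('b set \<Rightarrow> 'a) \<Rightarrow> 'b set set \<Rightarrow> ('a, 'k::field_char_0) upoly" where
  "dot_power om \<tau> = (\<Prod>C\<in>\<tau>. umb (om C) ^ card C)"

text \<open>
  The tuples \<open>(\<pi>, \<dots>, \<pi>')\<close> of partitions of the index sets \<open>J 0, \<dots>, J (r - 1)\<close>, and the set of
  all blocks of such a tuple.
\<close>

definition partition_tuples :: "nat \<Rightarrow> (nat \<Rightarrow> 'j set) \<Rightarrow> (nat \<Rightarrow> 'j set set) set" where
  "partition_tuples r J = (\<Pi>\<^sub>E i\<in>{..<r}. {P. partition_on (J i) P})"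

definition all_blocks :: "nat \<Rightarrow> (nat \<Rightarrow> 'j set set) \<Rightarrow> 'j set set" where
  "all_blocks r \<pi> = (\<Union>i<r. \<pi> i)"

end

theory Submission
  imports Defs
begin

text \<open>
  The proof is Moebius inversion on the lattice of set partitions, and it rests on three readings
  of the number \<open>c\<^sub>m = (- 1)\<^sup>m\<^sup>-\<^sup>1 (m - 1)!\<close> for \<open>m \<ge> 1\<close>, with \<open>c\<^sub>0 = 1\<close>: it is the \<open>m\<close>th moment of
  \<open>\<chi>.\<chi>\<close>, the value \<open>E[(\<chi>)\<^sub>m]\<close>, and the Moebius function of the partition lattice of an
  \<open>m\<close>-element set between the discrete and the one-block partition.

  Write \<open>a\<^sub>B\<close> for the joint moment of the monomials indexed by \<open>B\<close>. Multiplying out a product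
  of power sums \<open>n.\<mu>\<^sub>j\<close>, \<open>j \<in> J\<close>, means choosing a copy number \<open>f j \<in> {1..n}\<close> for every factor;
  since different copies are uncorrelated and similar to the originals, the choice \<open>f\<close> evaluates to
  the product of the moments of its fibres (\<open>E_prod_dot\<close>). Collecting the functions \<open>f\<close> by
  their kernel gives the moment polynomial \<open>\<Sum>\<^sub>\<pi> (n)\<^bsub>|\<pi>|\<^esub> \<Prod>\<^sub>B\<^sub>\<in>\<^sub>\<pi> a\<^sub>B\<close>; substituting
  \<open>\<chi>\<close> for \<open>n\<close> turns \<open>(n)\<^bsub>|\<pi>|\<^esub>\<close> into \<open>c\<^bsub>|\<pi>|\<^esub>\<close>. This expresses the
  cumulants (\<open>cumulant_eq\<close>), and labels do not matter, because a labelling is injective on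
  umbrae and preserves moments. So the polykay evaluates to the sum, over tuples of partitions, of
  \<open>c\<^bsub>|\<pi>|\<^esub> \<dots> c\<^bsub>|\<pi>'|\<^esub> \<Prod>\<^sub>B\<^sub>\<in>\<^sub>P a\<^sub>B\<close>, where \<open>P\<close> is the set of all blocks of the tuple.

  It remains to see that, for a fixed tuple,
  \<open>\<Sum>\<^sub>\<tau> c\<^sub>\<tau> E[(n.p)\<^bsub>S\<^sub>\<tau>\<^esub>] = (n)\<^bsub>|P|\<^esub> \<Prod>\<^sub>B\<^sub>\<in>\<^sub>P a\<^sub>B\<close>, where \<open>c\<^sub>\<tau>\<close> is the product of the
  \<open>c\<^bsub>|C|\<^esub>\<close> over the blocks \<open>C\<close> of \<open>\<tau>\<close>. Expand \<open>E[(n.p)\<^bsub>S\<^sub>\<tau>\<^esub>]\<close> as a sum over the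
  functions \<open>f : P \<rightarrow> {1..n}\<close> that are constant on the blocks of \<open>\<tau>\<close>, and exchange the sums:
  the coefficient of \<open>f\<close> is the sum of \<open>c\<^sub>\<tau>\<close> over all \<open>\<tau>\<close> refining the kernel of \<open>f\<close>, which is 1
  for injective \<open>f\<close> and 0 otherwise (\<open>sum_moebius_refining_kernel\<close>). There are
  \<open>(n)\<^bsub>|P|\<^esub>\<close> injective functions, and each of them contributes \<open>\<Prod>\<^sub>B\<^sub>\<in>\<^sub>P a\<^sub>B\<close>
  (\<open>moebius_sum_over_partitions\<close>). The factor \<open>(n)\<^bsub>|P|\<^esub>\<close> may be cancelled because
  \<open>|P| \<le> |T| + \<dots> + |L| < n\<close>.
\<close>

section \<open>Moebius inversion over set partitions\<close>

text \<open>
  The value 1 at \<open>m = 0\<close> makes this the zeroth moment as well. It occurs for an empty multiset,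
  whose only partition has no blocks.
\<close>

definition chi_dot_chi_moment :: "nat \<Rightarrow> 'k::field_char_0" where
  "chi_dot_chi_moment m = (if m = 0 then 1 else (- 1) ^ (m - 1) * fact (m - 1))"

lemma chi_dot_chi_moment_0 [simp]: "chi_dot_chi_moment 0 = 1"
  and chi_dot_chi_moment_1 [simp]: "chi_dot_chi_moment (Suc 0) = 1"
  by (simp_all add: chi_dot_chi_moment_def)

lemma chi_dot_chi_moment_Suc:
  "m > 0 \<Longrightarrow> chi_dot_chi_moment (Suc m) =
     - of_nat m * (chi_dot_chi_moment m :: 'k::field_char_0)"
  by (cases m) (simp_all add: chi_dot_chi_moment_def algebra_simps)

lemma partition_on_block_eq:
  assumes "partition_on X P" "B \<in> P" "C \<in> P" "x \<in> B" "x \<in> C"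
  shows "B = C"
  using assms unfolding partition_on_def disjoint_def by blast

lemma partition_on_Int_eq_empty:
  "partition_on X P \<Longrightarrow> B \<in> P \<Longrightarrow> C \<in> P \<Longrightarrow> B \<noteq> C \<Longrightarrow> B \<inter> C = {}"
  unfolding partition_on_def disjoint_def by blast

lemma partition_on_block_nonempty:
  "partition_on X P \<Longrightarrow> C \<in> P \<Longrightarrow> \<exists>x. x \<in> C"
  using partition_onD3 by (metis ex_in_conv)

text \<open>
  A partition of \<open>X\<close> with one more element \<open>x\<close> either has the new block \<open>{x}\<close> or arises by putting
  \<open>x\<close> into one of the existing blocks \<open>C\<close>.
\<close>

lemma sum_partitions_insert:
  fixes h :: "'x set set \<Rightarrow> 'b::comm_monoid_add"
  assumes X: "finite X" and x: "x \<notin> X"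
  shows "(\<Sum>\<tau> | partition_on (insert x X) \<tau>. h \<tau>) =
     (\<Sum>\<tau> | partition_on X \<tau>. h (insert {x} \<tau>) + (\<Sum>C\<in>\<tau>. h (insert (insert x C) (\<tau> - {C}))))"
proof -
  let ?P = "{\<tau>. partition_on X \<tau>}"
  let ?Q1 = "{\<tau>. partition_on (insert x X) \<tau> \<and> {x} \<in> \<tau>}"
  let ?Q2 = "{\<tau>. partition_on (insert x X) \<tau> \<and> {x} \<notin> \<tau>}"
  have fin: "finite \<tau>" if "\<tau> \<in> ?P" for \<tau>
    using that X finite_elements by blast
  have "(\<Sum>\<tau> | partition_on (insert x X) \<tau>. h \<tau>) = sum h (?Q1 \<union> ?Q2)"
    by (rule sum.cong) auto
  also have "\<dots> = sum h ?Q1 + sum h ?Q2"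
    using X by (intro sum.union_disjoint)
      (auto intro: finite_subset[OF _ finitely_many_partition_on[of "insert x X"]])
  also have "sum h ?Q1 = (\<Sum>\<tau>\<in>?P. h (insert {x} \<tau>))"
  proof (rule sum.reindex_bij_witness[of _ "insert {x}" "\<lambda>\<tau>. \<tau> - {{x}}"])
    fix \<tau> assume "\<tau> \<in> ?Q1"
    hence t: "partition_on (insert x X) \<tau>" "{x} \<in> \<tau>" by auto
    show "insert {x} (\<tau> - {{x}}) = \<tau>" using t by auto
    have "disjnt {x} (\<Union>(\<tau> - {{x}}))"
      using partition_on_block_eq[OF t] by (auto simp: disjnt_def)
    hence "partition_on (insert x X) (insert {x} (\<tau> - {{x}})) \<longleftrightarrow>
        partition_on (insert x X - {x}) (\<tau> - {{x}}) \<and> {x} \<subseteq> insert x X \<and> {x} \<noteq> {}"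
      by (rule partition_on_insert)
    moreover have "insert {x} (\<tau> - {{x}}) = \<tau>" "insert x X - {x} = X" using t x by auto
    ultimately show "\<tau> - {{x}} \<in> ?P" using t by simp
  next
    fix \<tau> assume t: "\<tau> \<in> ?P"
    have X_eq: "X = \<Union>\<tau>" using t by (auto dest: partition_onD1)
    have nx: "{x} \<notin> \<tau>" using x X_eq by auto
    thus "insert {x} \<tau> - {{x}} = \<tau>" by auto
    have "disjnt {x} (\<Union>\<tau>)" using x X_eq by auto
    from partition_on_insert[OF this, of "insert x X"] t x
    show "insert {x} \<tau> \<in> ?Q1" by auto
  qed (auto simp: insert_absorb)
  also have "sum h ?Q2 = (\<Sum>(\<tau>, C)\<in>Sigma ?P (\<lambda>\<tau>. \<tau>). h (insert (insert x C) (\<tau> - {C})))"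
  proof (rule sum.reindex_bij_witness[of _ "\<lambda>(\<tau>, C). insert (insert x C) (\<tau> - {C})"
        "\<lambda>\<tau>. (let B = (THE B. B \<in> \<tau> \<and> x \<in> B) in (insert (B - {x}) (\<tau> - {B}), B - {x}))"])
    fix \<tau> assume "\<tau> \<in> ?Q2"
    hence t: "partition_on (insert x X) \<tau>" "{x} \<notin> \<tau>" by auto
    have un: "insert x X = \<Union>\<tau>" using t partition_onD1 by blast
    then obtain B where B: "B \<in> \<tau>" "x \<in> B" by blast
    have the: "(THE B. B \<in> \<tau> \<and> x \<in> B) = B"
    proof (rule the_equality)
      show "D = B" if "D \<in> \<tau> \<and> x \<in> D" for D
        using that by (intro partition_on_block_eq[OF t(1) _ B(1) _ B(2)]) simp_all
    qed (use B in simp)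
    have "B \<noteq> {x}" using B(1) t(2) by metis
    hence Bx: "B - {x} \<noteq> {}" using B(2) by blast
    have dis: "D \<inter> B = {}" if "D \<in> \<tau> - {B}" for D
      using that B partition_on_Int_eq_empty[OF t(1)] by auto
    have BxD: "B - {x} \<notin> \<tau> - {B}" using dis Bx by blast
    have ins: "insert x (B - {x}) = B" using B by auto
    have eq: "insert (insert x (B - {x})) (insert (B - {x}) (\<tau> - {B}) - {B - {x}}) = \<tau>"
      using BxD B by (simp add: ins insert_absorb)
    show "(case (let B = (THE B. B \<in> \<tau> \<and> x \<in> B) in (insert (B - {x}) (\<tau> - {B}), B - {x})) of
        (\<tau>, C) \<Rightarrow> insert (insert x C) (\<tau> - {C})) = \<tau>"
      unfolding the Let_def prod.case by (rule eq)
    have d1: "disjnt B (\<Union>(\<tau> - {B}))" using dis by (auto simp: disjnt_def)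
    have "partition_on (insert x X) (insert B (\<tau> - {B}))" using t B by (simp add: insert_absorb)
    hence p1: "partition_on (insert x X - B) (\<tau> - {B})"
      using partition_on_insert[OF d1] by blast
    have d2: "disjnt (B - {x}) (\<Union>(\<tau> - {B}))" using d1 by (auto simp: disjnt_def)
    have "X - (B - {x}) = insert x X - B" using B x by auto
    hence p2: "partition_on X (insert (B - {x}) (\<tau> - {B}))"
      using partition_on_insert[OF d2, of X] p1 Bx un B by auto
    thus "(let B = (THE B. B \<in> \<tau> \<and> x \<in> B) in (insert (B - {x}) (\<tau> - {B}), B - {x}))
        \<in> Sigma ?P (\<lambda>\<tau>. \<tau>)"
      unfolding the Let_def by simp
    show "(case (let B = (THE B. B \<in> \<tau> \<and> x \<in> B) in (insert (B - {x}) (\<tau> - {B}), B - {x})) of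
        (\<tau>, C) \<Rightarrow> h (insert (insert x C) (\<tau> - {C}))) = h \<tau>"
      unfolding the Let_def prod.case eq ..
  next
    fix p assume "p \<in> Sigma ?P (\<lambda>\<tau>. \<tau>)"
    then obtain \<tau> C where p: "p = (\<tau>, C)" and t: "partition_on X \<tau>" and C: "C \<in> \<tau>" by auto
    have un: "X = \<Union>\<tau>" using t partition_onD1 by blast
    have xD: "x \<notin> D" if "D \<in> \<tau>" for D using that un x by blast
    have Cne: "C \<noteq> {}" using C t partition_onD3 by metis
    have dis: "D \<inter> C = {}" if "D \<in> \<tau> - {C}" for D
      using that C partition_on_Int_eq_empty[OF t] by auto
    let ?\<sigma> = "insert (insert x C) (\<tau> - {C})"
    have the: "(THE B. B \<in> ?\<sigma> \<and> x \<in> B) = insert x C"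
      using xD by (intro the_equality) auto
    have m: "insert x C - {x} = C" "?\<sigma> - {insert x C} = \<tau> - {C}" using xD C by auto
    show "(let B = (THE B. B \<in> (case p of (\<tau>, C) \<Rightarrow> insert (insert x C) (\<tau> - {C})) \<and> x \<in> B) in
        (insert (B - {x}) ((case p of (\<tau>, C) \<Rightarrow> insert (insert x C) (\<tau> - {C})) - {B}), B - {x})) = p"
      unfolding p prod.case the Let_def m using C by (simp add: insert_absorb)
    have d1: "disjnt C (\<Union>(\<tau> - {C}))" using dis by (auto simp: disjnt_def)
    have "partition_on X (insert C (\<tau> - {C}))" using t C by (simp add: insert_absorb)
    hence p1: "partition_on (X - C) (\<tau> - {C})" using partition_on_insert[OF d1] by blast
    have d2: "disjnt (insert x C) (\<Union>(\<tau> - {C}))" using d1 xD by (auto simp: disjnt_def)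
    have "insert x X - insert x C = X - C" using xD[OF C] x by auto
    hence "partition_on (insert x X) ?\<sigma>"
      using partition_on_insert[OF d2, of "insert x X"] p1 un C by auto
    moreover have "{x} \<notin> ?\<sigma>" using xD Cne C by auto
    ultimately show "(case p of (\<tau>, C) \<Rightarrow> insert (insert x C) (\<tau> - {C})) \<in> ?Q2"
      unfolding p by simp
  qed
  also have "\<dots> = (\<Sum>\<tau>\<in>?P. \<Sum>C\<in>\<tau>. h (insert (insert x C) (\<tau> - {C})))"
    using fin finitely_many_partition_on[OF X] by (subst sum.Sigma) auto
  finally show ?thesis by (simp add: sum.distrib)
qed

definition constant_on :: "'x set \<Rightarrow> ('x \<Rightarrow> 'y) \<Rightarrow> bool" where
  "constant_on C f \<longleftrightarrow> (\<forall>x\<in>C. \<forall>y\<in>C. f x = f y)"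

text \<open>
  For \<open>f\<close> constant on a set with at least two elements, this is the vanishing of the sum of the Moebius
  function; the version relative to a kernel is what inversion needs, and it has a short induction. When \<open>x\<close> joins \<open>X\<close>, opening the
  block \<open>{x}\<close> keeps the weight of \<open>\<tau>\<close>, and joining a block \<open>C\<close> is compatible with \<open>f\<close> only if \<open>f\<close>
  takes the value \<open>f x\<close> on \<open>C\<close>, in which case it multiplies the weight by \<open>- |C|\<close>. Altogether the
  weight of \<open>\<tau>\<close> gets the factor \<open>1 - |{y \<in> X. f y = f x}|\<close>, the same for all \<open>\<tau>\<close>. If \<open>f\<close> is
  injective on \<open>X\<close>, that factor is 1 or 0 according to whether the value \<open>f x\<close> is new.
\<close>

lemma sum_moebius_refining_kernel:
  fixes f :: "'x \<Rightarrow> 'y"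
  assumes "finite X"
  shows "(\<Sum>\<tau> | partition_on X \<tau> \<and> (\<forall>C\<in>\<tau>. constant_on C f).
            \<Prod>C\<in>\<tau>. chi_dot_chi_moment (card C)) =
         (if inj_on f X then 1 else 0 :: 'k::field_char_0)"
proof -
  (* Building the compatibility with f into the weight of a block lets the recursion run over
     all partitions. *)
  define w :: "'x set \<Rightarrow> 'k"
    where "w C = (if constant_on C f then chi_dot_chi_moment (card C) else 0)" for C
  have w_prod: "prod w \<tau> = (if \<forall>C\<in>\<tau>. constant_on C f
      then \<Prod>C\<in>\<tau>. chi_dot_chi_moment (card C) else 0)"
    if "finite \<tau>" for \<tau>
    using that by (auto simp: w_def intro!: prod_zero)
  have sum_w: "(\<Sum>\<tau> | partition_on X \<tau>. prod w \<tau>) = (if inj_on f X then 1 else 0)"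
    using assms
  proof (induction X rule: finite_induct)
    case empty
    have "{\<tau>. partition_on {} \<tau>} = {{} :: 'x set set}" by (auto simp: partition_on_empty)
    thus ?case by simp
  next
    case (insert x X)
    let ?F = "{y \<in> X. f y = f x}"
    have step: "prod w (insert {x} \<tau>) + (\<Sum>C\<in>\<tau>. prod w (insert (insert x C) (\<tau> - {C}))) =
        prod w \<tau> * (1 - of_nat (card ?F))" if t: "partition_on X \<tau>" for \<tau>
    proof (cases "\<forall>C\<in>\<tau>. constant_on C f")
      case False
      then obtain D where D: "D \<in> \<tau>" "\<not> constant_on D f" by blast
      have fin: "finite \<tau>" using t insert finite_elements by blast
      have z: "prod w \<sigma> = 0" if "finite \<sigma>" "D' \<in> \<sigma>" "D \<subseteq> D'" for \<sigma> D'
      proof -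
        have "w D' = 0" using that D unfolding w_def constant_on_def by (meson subsetD)
        thus ?thesis using that by (intro prod_zero) auto
      qed
      have z2: "prod w (insert (insert x C) (\<tau> - {C})) = 0" for C
      proof (cases "C = D")
        case True
        show ?thesis by (rule z[where D' = "insert x C"]) (use fin True in auto)
      next
        case False
        show ?thesis by (rule z[where D' = D]) (use fin False D in auto)
      qed
      have "prod w \<tau> = 0" "prod w (insert {x} \<tau>) = 0"
        using z[of \<tau> D] z[of "insert {x} \<tau>" D] fin D by blast+
      thus ?thesis by (simp only: z2 sum.neutral_const) simp
    next
      case True
      have fin: "finite \<tau>" using t insert finite_elements by blast
      have un: "X = \<Union>\<tau>" using t partition_onD1 by blast
      have finC: "finite C" if "C \<in> \<tau>" for C
        using that un insert by (metis Sup_upper finite_subset)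
      have xD: "x \<notin> D" if "D \<in> \<tau>" for D using that un insert by blast
      have ne: "C \<noteq> {}" if "C \<in> \<tau>" for C using that t partition_onD3 by metis
      have w1: "w {x} = 1" by (simp add: w_def constant_on_def)
      have "{x} \<notin> \<tau>" using xD by auto
      hence 1: "prod w (insert {x} \<tau>) = prod w \<tau>" using fin w1 by simp
      have 2: "prod w (insert (insert x C) (\<tau> - {C})) =
          - prod w \<tau> * of_nat (card (C \<inter> ?F))" if C: "C \<in> \<tau>" for C
      proof -
        have "insert x C \<notin> \<tau> - {C}" using xD by blast
        hence "prod w (insert (insert x C) (\<tau> - {C})) = w (insert x C) * prod w (\<tau> - {C})"
          using fin by simp
        moreover have "w (insert x C) = - of_nat (card (C \<inter> ?F)) * w C"
        proof (cases "\<exists>y\<in>C. f y = f x")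
          case True
          then obtain y where y: "y \<in> C" "f y = f x" by blast
          have "f z = f x" if "z \<in> C" for z
            using \<open>\<forall>C\<in>\<tau>. constant_on C f\<close> C y that unfolding constant_on_def by metis
          hence c: "constant_on (insert x C) f" and cF: "C \<inter> ?F = C"
            using C un by (auto simp: constant_on_def)
          have "card C > 0" using ne[OF C] finC[OF C] by (simp add: card_gt_0_iff)
          thus ?thesis
            using c cF xD[OF C] finC[OF C] True \<open>\<forall>C\<in>\<tau>. constant_on C f\<close> C
            by (simp add: w_def chi_dot_chi_moment_Suc)
        next
          case False
          hence "\<not> constant_on (insert x C) f" using ne[OF C] unfolding constant_on_def by auto
          moreover have "C \<inter> ?F = {}" using False by auto
          ultimately show ?thesis by (simp add: w_def)
        qed
        moreover have "w C * prod w (\<tau> - {C}) = prod w \<tau>"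
          using fin C by (simp add: prod.remove)
        ultimately show ?thesis by (simp add: mult.assoc)
      qed
      have "?F = (\<Union>C\<in>\<tau>. C \<inter> ?F)" using un by auto
      moreover have "card (\<Union>C\<in>\<tau>. C \<inter> ?F) = (\<Sum>C\<in>\<tau>. card (C \<inter> ?F))"
        using fin finC partition_on_Int_eq_empty[OF t] by (intro card_UN_disjoint) fast+
      ultimately have "card ?F = (\<Sum>C\<in>\<tau>. card (C \<inter> ?F))" by simp
      thus ?thesis by (simp add: 1 2 sum_distrib_left sum_negf algebra_simps)
    qed
    have "(\<Sum>\<tau> | partition_on (insert x X) \<tau>. prod w \<tau>) =
        (\<Sum>\<tau> | partition_on X \<tau>. prod w \<tau>) * (1 - of_nat (card ?F))"
      unfolding sum_partitions_insert[OF insert.hyps] sum_distrib_right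
      by (rule sum.cong) (simp_all add: step)
    also have "\<dots> = (if inj_on f X then 1 else 0) * (1 - of_nat (card ?F))"
      using insert.IH by simp
    also have "\<dots> = (if inj_on f (insert x X) then 1 else 0)"
    proof (cases "inj_on f X")
      case inj: True
      show ?thesis
      proof (cases "\<exists>y\<in>X. f y = f x")
        case True
        then obtain y where y: "y \<in> X" "f y = f x" by blast
        have "z = y" if "z \<in> X" "f z = f x" for z
          using inj y that by (metis inj_onD)
        hence "?F = {y}" using y by blast
        moreover have "f x \<in> f ` X" using y by (metis imageI)
        ultimately show ?thesis using inj insert.hyps by simp
      next
        case False
        hence "?F = {}" by blast
        moreover have "inj_on f (insert x X)" using inj False insert.hyps by fastforce
        ultimately show ?thesis using inj by (simp only: card.empty of_nat_0 diff_zero if_True mult_1)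
      qed
    qed simp
    finally show ?case .
  qed
  have "(\<Sum>\<tau> | partition_on X \<tau>. prod w \<tau>) =
      (\<Sum>\<tau> | partition_on X \<tau> \<and> (\<forall>C\<in>\<tau>. constant_on C f).
         \<Prod>C\<in>\<tau>. chi_dot_chi_moment (card C))"
    using assms finite_elements[OF assms]
    by (intro sum.mono_neutral_cong_right finitely_many_partition_on) (auto simp: w_prod)
  with sum_w show ?thesis by simp
qed

section \<open>Functions and their kernels\<close>

lemma card_injections:
  assumes "finite X" "finite Y"
  shows "of_nat (card {g \<in> X \<rightarrow>\<^sub>E Y. inj_on g X}) = (falling (of_nat (card Y)) (card X) :: 'k::field_char_0)"
  using assms(1)
proof (induction X rule: finite_induct)
  case empty
  have "{g \<in> {} \<rightarrow>\<^sub>E Y. inj_on g {}} = {\<lambda>_. undefined}" by auto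
  thus ?case by (simp add: falling_def)
next
  case (insert x X)
  let ?I = "{g \<in> X \<rightarrow>\<^sub>E Y. inj_on g X}"
  have fin: "finite ?I" using insert.hyps assms(2) by (simp add: finite_PiE)
  have "bij_betw (\<lambda>(g, y). g(x := y)) (Sigma ?I (\<lambda>g. Y - g ` X))
      {g \<in> insert x X \<rightarrow>\<^sub>E Y. inj_on g (insert x X)}"
  proof (rule bij_betw_byWitness[where f' = "\<lambda>g. (g(x := undefined), g x)"])
    show "\<forall>a\<in>Sigma ?I (\<lambda>g. Y - g ` X).
        (\<lambda>g. (g(x := undefined), g x)) (case a of (g, y) \<Rightarrow> g(x := y)) = a"
    proof
      fix a assume "a \<in> Sigma ?I (\<lambda>g. Y - g ` X)"
      then obtain g y where a: "a = (g, y)" and g: "g \<in> X \<rightarrow>\<^sub>E Y" by blast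
      have "g x = undefined" using g insert.hyps by (auto intro: PiE_arb)
      thus "(\<lambda>g. (g(x := undefined), g x)) (case a of (g, y) \<Rightarrow> g(x := y)) = a"
        by (simp add: a fun_upd_idem)
    qed
    show "(\<lambda>(g, y). g(x := y)) ` Sigma ?I (\<lambda>g. Y - g ` X)
        \<subseteq> {g \<in> insert x X \<rightarrow>\<^sub>E Y. inj_on g (insert x X)}"
    proof (rule image_subsetI)
      fix a assume "a \<in> Sigma ?I (\<lambda>g. Y - g ` X)"
      then obtain g y where a: "a = (g, y)" and g: "g \<in> X \<rightarrow>\<^sub>E Y" "inj_on g X"
        and y: "y \<in> Y" "y \<notin> g ` X" by blast
      have agree: "(g(x := y)) z = g z" if "z \<in> X" for z using that insert.hyps by auto
      have "inj_on (g(x := y)) X" using g(2) inj_on_cong[of X "g(x := y)" g] agree by blast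
      moreover have "(g(x := y)) ` X = g ` X" using agree by (intro image_cong) simp_all
      moreover have "g(x := y) \<in> insert x X \<rightarrow>\<^sub>E Y" using g(1) y(1) by (intro PiE_fun_upd)
      ultimately have "g(x := y) \<in> insert x X \<rightarrow>\<^sub>E Y \<and> inj_on (g(x := y)) (insert x X)"
        using y(2) insert.hyps by simp
      thus "(case a of (g, y) \<Rightarrow> g(x := y)) \<in> {g \<in> insert x X \<rightarrow>\<^sub>E Y. inj_on g (insert x X)}"
        by (simp only: a prod.case mem_Collect_eq)
    qed
    show "(\<lambda>g. (g(x := undefined), g x)) ` {g \<in> insert x X \<rightarrow>\<^sub>E Y. inj_on g (insert x X)}
        \<subseteq> Sigma ?I (\<lambda>g. Y - g ` X)"
    proof (rule image_subsetI)
      fix g assume "g \<in> {g \<in> insert x X \<rightarrow>\<^sub>E Y. inj_on g (insert x X)}"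
      hence g: "g \<in> insert x X \<rightarrow>\<^sub>E Y" "inj_on g X" "g x \<notin> g ` X"
        using insert.hyps by simp_all
      let ?g = "g(x := undefined)"
      have agree: "?g z = g z" if "z \<in> X" for z using that insert.hyps by auto
      have "inj_on ?g X" using g(2) inj_on_cong[of X ?g g] agree by blast
      moreover have "?g ` X = g ` X" using agree by (intro image_cong) simp_all
      moreover have "?g \<in> X \<rightarrow>\<^sub>E Y" using g(1) insert.hyps by (intro fun_upd_in_PiE)
      moreover have "g x \<in> Y" using g(1) by (rule PiE_mem) simp
      ultimately show "(?g, g x) \<in> Sigma ?I (\<lambda>g. Y - g ` X)" using g(3) by simp
    qed
    show "\<forall>g\<in>{g \<in> insert x X \<rightarrow>\<^sub>E Y. inj_on g (insert x X)}.
        (case (g(x := undefined), g x) of (g, y) \<Rightarrow> g(x := y)) = g" by simp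
  qed
  hence "card {g \<in> insert x X \<rightarrow>\<^sub>E Y. inj_on g (insert x X)} = card (Sigma ?I (\<lambda>g. Y - g ` X))"
    by (simp add: bij_betw_same_card)
  also have "\<dots> = (\<Sum>g\<in>?I. card (Y - g ` X))"
    using fin assms(2) by (simp add: card_SigmaI)
  finally have "of_nat (card {g \<in> insert x X \<rightarrow>\<^sub>E Y. inj_on g (insert x X)}) =
      (\<Sum>g\<in>?I. of_nat (card (Y - g ` X)) :: 'k)" by simp
  also have "\<dots> = (\<Sum>g\<in>?I. of_nat (card Y) - of_nat (card X))"
  proof (rule sum.cong[OF refl])
    fix g assume "g \<in> ?I"
    hence g: "g ` X \<subseteq> Y" "card (g ` X) = card X" by (auto simp: card_image)
    hence "card X \<le> card Y" using assms(2) by (metis card_mono)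
    thus "of_nat (card (Y - g ` X)) = (of_nat (card Y) - of_nat (card X) :: 'k)"
      using g insert.hyps by (simp add: card_Diff_subset of_nat_diff)
  qed
  also have "\<dots> = falling (of_nat (card Y)) (card X) * (of_nat (card Y) - of_nat (card X))"
    by (simp add: insert.IH)
  also have "\<dots> = falling (of_nat (card Y)) (card (insert x X))"
    using insert.hyps by (simp add: falling_def)
  finally show ?case .
qed

definition block_of :: "'x set set \<Rightarrow> 'x \<Rightarrow> 'x set" where
  "block_of \<tau> x = (THE C. C \<in> \<tau> \<and> x \<in> C)"

lemma block_of_eq:
  assumes "partition_on X \<tau>" "C \<in> \<tau>" "x \<in> C"
  shows "block_of \<tau> x = C"
  unfolding block_of_def
proof (rule the_equality)
  show "D = C" if "D \<in> \<tau> \<and> x \<in> D" for D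
    using that assms by (intro partition_on_block_eq[OF assms(1) _ assms(2) _ assms(3)]) simp_all
qed (use assms in simp)

lemma block_of_in:
  assumes "partition_on X \<tau>" "x \<in> X"
  shows "block_of \<tau> x \<in> \<tau>" "x \<in> block_of \<tau> x"
proof -
  obtain C where "C \<in> \<tau>" "x \<in> C" using assms partition_onD1[OF assms(1)] by blast
  thus "block_of \<tau> x \<in> \<tau>" "x \<in> block_of \<tau> x" using block_of_eq[OF assms(1)] by simp_all
qed

text \<open>
  Composition with the quotient map \<open>X \<rightarrow> \<tau>\<close>, by which the functions on the set of blocks correspond
  to the functions on \<open>X\<close> that are constant on blocks.
\<close>

definition blockwise :: "'x set \<Rightarrow> 'x set set \<Rightarrow> ('x set \<Rightarrow> 'y) \<Rightarrow> 'x \<Rightarrow> 'y" where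
  "blockwise X \<tau> g = (\<lambda>x\<in>X. g (block_of \<tau> x))"

lemma blockwise_eq:
  assumes "partition_on X \<tau>" "C \<in> \<tau>" "x \<in> C"
  shows "blockwise X \<tau> g x = g C"
  using assms block_of_eq[OF assms] partition_onD1[OF assms(1)] by (auto simp: blockwise_def)

lemma bij_betw_blockwise:
  fixes X :: "'x set" and Y :: "'y set"
  assumes \<tau>: "partition_on X \<tau>"
  shows "bij_betw (blockwise X \<tau>) (\<tau> \<rightarrow>\<^sub>E Y) {f \<in> X \<rightarrow>\<^sub>E Y. \<forall>C\<in>\<tau>. constant_on C f}"
proof (rule bij_betw_byWitness[where f' = "\<lambda>f. \<lambda>C\<in>\<tau>. f (SOME x. x \<in> C)"])
  have some: "(SOME x. x \<in> C) \<in> C" if "C \<in> \<tau>" for C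
    using that partition_onD3[OF \<tau>] by (metis ex_in_conv someI_ex)
  have sub: "C \<subseteq> X" if "C \<in> \<tau>" for C
    using that partition_onD1[OF \<tau>] by blast
  show "\<forall>g\<in>\<tau> \<rightarrow>\<^sub>E Y. (\<lambda>C\<in>\<tau>. blockwise X \<tau> g (SOME x. x \<in> C)) = g"
  proof
    fix g :: "'x set \<Rightarrow> 'y" assume g: "g \<in> \<tau> \<rightarrow>\<^sub>E Y"
    show "(\<lambda>C\<in>\<tau>. blockwise X \<tau> g (SOME x. x \<in> C)) = g"
    proof
      fix C show "(\<lambda>C\<in>\<tau>. blockwise X \<tau> g (SOME x. x \<in> C)) C = g C"
        using blockwise_eq[OF \<tau> _ some, of C g] PiE_arb[OF g, of C] by (cases "C \<in> \<tau>") simp_all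
    qed
  qed
  show "\<forall>f\<in>{f \<in> X \<rightarrow>\<^sub>E Y. \<forall>C\<in>\<tau>. constant_on C f}.
      blockwise X \<tau> (\<lambda>C\<in>\<tau>. f (SOME x. x \<in> C)) = f"
  proof
    fix f assume f: "f \<in> {f \<in> X \<rightarrow>\<^sub>E Y. \<forall>C\<in>\<tau>. constant_on C f}"
    have "f (SOME y. y \<in> block_of \<tau> x) = f x" if "x \<in> X" for x
      using f block_of_in[OF \<tau> that] some unfolding constant_on_def by blast
    hence "blockwise X \<tau> (\<lambda>C\<in>\<tau>. f (SOME x. x \<in> C)) x = f x" for x
      using f block_of_in(1)[OF \<tau>, of x] PiE_arb[of f X "\<lambda>_. Y" x]
      by (cases "x \<in> X") (simp_all add: blockwise_def)
    thus "blockwise X \<tau> (\<lambda>C\<in>\<tau>. f (SOME x. x \<in> C)) = f" by (rule ext)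
  qed
  show "blockwise X \<tau> ` (\<tau> \<rightarrow>\<^sub>E Y) \<subseteq> {f \<in> X \<rightarrow>\<^sub>E Y. \<forall>C\<in>\<tau>. constant_on C f}"
  proof (rule image_subsetI)
    fix g :: "'x set \<Rightarrow> 'y" assume g: "g \<in> \<tau> \<rightarrow>\<^sub>E Y"
    have "blockwise X \<tau> g \<in> X \<rightarrow>\<^sub>E Y"
      unfolding blockwise_def using PiE_mem[OF g block_of_in(1)[OF \<tau>]] by simp
    moreover have "constant_on C (blockwise X \<tau> g)" if "C \<in> \<tau>" for C
      unfolding constant_on_def by (simp add: blockwise_eq[OF \<tau> that])
    ultimately show "blockwise X \<tau> g \<in> {f \<in> X \<rightarrow>\<^sub>E Y. \<forall>C\<in>\<tau>. constant_on C f}" by simp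
  qed
  show "(\<lambda>f. \<lambda>C\<in>\<tau>. f (SOME x. x \<in> C)) ` {f \<in> X \<rightarrow>\<^sub>E Y. \<forall>C\<in>\<tau>. constant_on C f} \<subseteq> \<tau> \<rightarrow>\<^sub>E Y"
  proof (rule image_subsetI)
    fix f :: "'x \<Rightarrow> 'y" assume "f \<in> {f \<in> X \<rightarrow>\<^sub>E Y. \<forall>C\<in>\<tau>. constant_on C f}"
    hence f: "f \<in> X \<rightarrow>\<^sub>E Y" by simp
    have "f (SOME x. x \<in> C) \<in> Y" if "C \<in> \<tau>" for C
      using PiE_mem[OF f subsetD[OF sub[OF that] some[OF that]]] .
    thus "(\<lambda>C\<in>\<tau>. f (SOME x. x \<in> C)) \<in> \<tau> \<rightarrow>\<^sub>E Y" by simp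
  qed
qed

lemma fibre_blockwise:
  assumes "partition_on X \<tau>"
  shows "{x \<in> X. blockwise X \<tau> g x = y} = \<Union>{C \<in> \<tau>. g C = y}"
proof (intro equalityI subsetI)
  fix x assume "x \<in> {x \<in> X. blockwise X \<tau> g x = y}"
  hence "x \<in> X" "g (block_of \<tau> x) = y" by (auto simp: blockwise_def)
  thus "x \<in> \<Union>{C \<in> \<tau>. g C = y}" using block_of_in[OF assms, of x] by blast
next
  fix x assume "x \<in> \<Union>{C \<in> \<tau>. g C = y}"
  then obtain C where C: "C \<in> \<tau>" "x \<in> C" "g C = y" by blast
  hence "x \<in> X" using partition_onD1[OF assms] by blast
  thus "x \<in> {x \<in> X. blockwise X \<tau> g x = y}" using C blockwise_eq[OF assms C(1,2), of g] by simp
qed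

definition kernel_partition :: "'x set \<Rightarrow> ('x \<Rightarrow> 'y) \<Rightarrow> 'x set set" where
  "kernel_partition X f = (\<lambda>x. {y \<in> X. f y = f x}) ` X"

lemma partition_on_kernel: "partition_on X (kernel_partition X f)"
  unfolding kernel_partition_def by (rule partition_onI) (auto simp: disjnt_def)

lemma kernel_partition_blockwise:
  assumes \<tau>: "partition_on X \<tau>" and g: "inj_on g \<tau>"
  shows "kernel_partition X (blockwise X \<tau> g) = \<tau>"
proof -
  have fib: "{y \<in> X. blockwise X \<tau> g y = blockwise X \<tau> g x} = C" if "C \<in> \<tau>" "x \<in> C" for C x
  proof -
    have "{D \<in> \<tau>. g D = g C} = {C}" using g that by (auto dest: inj_onD)
    thus ?thesis unfolding fibre_blockwise[OF \<tau>] blockwise_eq[OF \<tau> that] by simp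
  qed
  show ?thesis
  proof (intro equalityI subsetI)
    fix C assume "C \<in> kernel_partition X (blockwise X \<tau> g)"
    thus "C \<in> \<tau>" using fib block_of_in[OF \<tau>] unfolding kernel_partition_def by fastforce
  next
    fix C assume C: "C \<in> \<tau>"
    then obtain x where x: "x \<in> C" using partition_on_block_nonempty[OF \<tau>] by blast
    hence "x \<in> X" using C partition_onD1[OF \<tau>] by blast
    thus "C \<in> kernel_partition X (blockwise X \<tau> g)"
      unfolding kernel_partition_def using fib[OF C x] by blast
  qed
qed

text \<open>
  The kernel of a function that is constant on blocks can be coarser than \<open>\<tau>\<close>; it is \<open>\<tau>\<close> itself
  when distinct blocks get distinct values.
\<close>

lemma functions_with_kernel:
  assumes \<tau>: "partition_on X \<tau>"
  shows "{f \<in> X \<rightarrow>\<^sub>E Y. kernel_partition X f = \<tau>} = blockwise X \<tau> ` {g \<in> \<tau> \<rightarrow>\<^sub>E Y. inj_on g \<tau>}"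
proof (intro equalityI subsetI)
  fix f assume f: "f \<in> {f \<in> X \<rightarrow>\<^sub>E Y. kernel_partition X f = \<tau>}"
  hence const: "\<forall>C\<in>\<tau>. constant_on C f" by (auto simp: kernel_partition_def constant_on_def)
  with f obtain g where g: "g \<in> \<tau> \<rightarrow>\<^sub>E Y" "f = blockwise X \<tau> g"
    using bij_betw_blockwise[OF \<tau>, of Y] unfolding bij_betw_def by blast
  have "inj_on g \<tau>"
  proof (rule inj_onI)
    fix C D assume CD: "C \<in> \<tau>" "D \<in> \<tau>" "g C = g D"
    then obtain x y where xy: "x \<in> C" "y \<in> D"
      using partition_on_block_nonempty[OF \<tau>] by blast
    hence "f x = f y" using CD blockwise_eq[OF \<tau>] g by metis
    moreover have "C = {z \<in> X. f z = f x}" "D = {z \<in> X. f z = f y}"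
      using f CD xy unfolding kernel_partition_def by auto
    ultimately show "C = D" by simp
  qed
  with g show "f \<in> blockwise X \<tau> ` {g \<in> \<tau> \<rightarrow>\<^sub>E Y. inj_on g \<tau>}" by blast
next
  fix f assume "f \<in> blockwise X \<tau> ` {g \<in> \<tau> \<rightarrow>\<^sub>E Y. inj_on g \<tau>}"
  then obtain g where g: "g \<in> \<tau> \<rightarrow>\<^sub>E Y" "inj_on g \<tau>" "f = blockwise X \<tau> g" by blast
  have "f \<in> X \<rightarrow>\<^sub>E Y" using g bij_betw_apply[OF bij_betw_blockwise[OF \<tau>, of Y]] by blast
  thus "f \<in> {f \<in> X \<rightarrow>\<^sub>E Y. kernel_partition X f = \<tau>}"
    using kernel_partition_blockwise[OF \<tau> g(2)] g(3) by simp
qed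

text \<open>
  All functions with kernel \<open>\<tau>\<close> contribute the same product, because their nonempty fibres are the
  blocks of \<open>\<tau>\<close>; empty fibres contribute \<open>a {} = 1\<close>. These functions correspond to the injections
  from \<open>\<tau>\<close> into \<open>Y\<close>, and the falling factorial counts them.
\<close>

lemma sum_functions_by_kernel:
  fixes a :: "'x set \<Rightarrow> 'k::field_char_0" and Y :: "'y set"
  assumes X: "finite X" and Y: "finite Y" and a: "a {} = 1"
  shows "(\<Sum>f\<in>X \<rightarrow>\<^sub>E Y. \<Prod>y\<in>Y. a {x \<in> X. f x = y}) =
     (\<Sum>\<tau> | partition_on X \<tau>. falling (of_nat (card Y)) (card \<tau>) * (\<Prod>C\<in>\<tau>. a C))"
proof -
  let ?W = "\<lambda>f. \<Prod>y\<in>Y. a {x \<in> X. f x = y}"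
  have "(\<Sum>f\<in>X \<rightarrow>\<^sub>E Y. ?W f) =
      (\<Sum>\<tau> | partition_on X \<tau>. \<Sum>f | f \<in> X \<rightarrow>\<^sub>E Y \<and> kernel_partition X f = \<tau>. ?W f)"
    using X Y by (intro sum.group[symmetric] finitely_many_partition_on finite_PiE)
      (auto simp: partition_on_kernel)
  also have "\<dots> = (\<Sum>\<tau> | partition_on X \<tau>. falling (of_nat (card Y)) (card \<tau>) * (\<Prod>C\<in>\<tau>. a C))"
  proof (rule sum.cong[OF refl])
    fix \<tau> assume "\<tau> \<in> {\<tau>. partition_on X \<tau>}"
    hence \<tau>: "partition_on X \<tau>" by simp
    have fin: "finite \<tau>" using X \<tau> finite_elements by blast
    let ?I = "{g \<in> \<tau> \<rightarrow>\<^sub>E Y. inj_on g \<tau>}"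
    have "inj_on (blockwise X \<tau>) ?I"
      using bij_betw_blockwise[OF \<tau>, of Y] by (auto simp: bij_betw_def intro: inj_on_subset)
    hence "(\<Sum>f | f \<in> X \<rightarrow>\<^sub>E Y \<and> kernel_partition X f = \<tau>. ?W f) = (\<Sum>g\<in>?I. ?W (blockwise X \<tau> g))"
      unfolding functions_with_kernel[OF \<tau>] by (simp add: sum.reindex)
    also have "\<dots> = (\<Sum>g\<in>?I. \<Prod>C\<in>\<tau>. a C)"
    proof (rule sum.cong[OF refl])
      fix g assume "g \<in> ?I"
      hence g: "g ` \<tau> \<subseteq> Y" "inj_on g \<tau>" by auto
      have "?W (blockwise X \<tau> g) = (\<Prod>y\<in>Y. a (\<Union>{C \<in> \<tau>. g C = y}))"
        by (simp only: fibre_blockwise[OF \<tau>])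
      also have "\<dots> = (\<Prod>y\<in>g ` \<tau>. a (\<Union>{C \<in> \<tau>. g C = y}))"
      proof (rule prod.mono_neutral_right[OF Y g(1)], rule ballI)
        fix y assume "y \<in> Y - g ` \<tau>"
        hence "{C \<in> \<tau>. g C = y} = {}" by auto
        thus "a (\<Union>{C \<in> \<tau>. g C = y}) = 1" by (simp only: Union_empty a)
      qed
      also have "\<dots> = (\<Prod>C\<in>\<tau>. a C)"
      proof (subst prod.reindex[OF g(2)], rule prod.cong[OF refl])
        fix C assume "C \<in> \<tau>"
        hence "{D \<in> \<tau>. g D = g C} = {C}" using g(2) by (auto dest: inj_onD)
        thus "((\<lambda>y. a (\<Union>{D \<in> \<tau>. g D = y})) \<circ> g) C = a C" by simp
      qed
      finally show "?W (blockwise X \<tau> g) = (\<Prod>C\<in>\<tau>. a C)" .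
    qed
    also have "\<dots> = falling (of_nat (card Y)) (card \<tau>) * (\<Prod>C\<in>\<tau>. a C)"
      by (simp add: card_injections[OF fin Y])
    finally show "(\<Sum>f | f \<in> X \<rightarrow>\<^sub>E Y \<and> kernel_partition X f = \<tau>. ?W f) =
        falling (of_nat (card Y)) (card \<tau>) * (\<Prod>C\<in>\<tau>. a C)" .
  qed
  finally show ?thesis .
qed

text \<open>
  The inner sum amounts to a sum over the functions on \<open>X\<close> that are constant on the blocks of \<open>\<tau>\<close>.
  After the two sums are exchanged, only the injective functions survive, and the fibres of these are
  singletons or empty.
\<close>

lemma moebius_sum_over_partitions:
  fixes b :: "'x set \<Rightarrow> 'k::field_char_0" and Y :: "'y set"
  assumes X: "finite X" and Y: "finite Y" and b: "b {} = 1"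
  shows "(\<Sum>\<tau> | partition_on X \<tau>. (\<Prod>C\<in>\<tau>. chi_dot_chi_moment (card C)) *
            (\<Sum>g\<in>\<tau> \<rightarrow>\<^sub>E Y. \<Prod>y\<in>Y. b (\<Union>{C \<in> \<tau>. g C = y}))) =
         falling (of_nat (card Y)) (card X) * (\<Prod>x\<in>X. b {x})"
proof -
  let ?W = "\<lambda>f. \<Prod>y\<in>Y. b {x \<in> X. f x = y}"
  let ?c = "\<lambda>\<tau>. \<Prod>C\<in>\<tau>. chi_dot_chi_moment (card C) :: 'k"
  let ?P = "{\<tau>. partition_on X \<tau>}"
  have finF: "finite (X \<rightarrow>\<^sub>E Y)" using X Y by (simp add: finite_PiE)
  have finP: "finite ?P" using X by (rule finitely_many_partition_on)
  have "(\<Sum>\<tau>\<in>?P. ?c \<tau> * (\<Sum>g\<in>\<tau> \<rightarrow>\<^sub>E Y. \<Prod>y\<in>Y. b (\<Union>{C \<in> \<tau>. g C = y}))) =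
      (\<Sum>\<tau>\<in>?P. \<Sum>f\<in>{f \<in> X \<rightarrow>\<^sub>E Y. \<forall>C\<in>\<tau>. constant_on C f}. ?c \<tau> * ?W f)"
  proof (rule sum.cong[OF refl])
    fix \<tau> assume "\<tau> \<in> ?P"
    hence \<tau>: "partition_on X \<tau>" by simp
    have "(\<Sum>f\<in>{f \<in> X \<rightarrow>\<^sub>E Y. \<forall>C\<in>\<tau>. constant_on C f}. ?W f) =
        (\<Sum>g\<in>\<tau> \<rightarrow>\<^sub>E Y. ?W (blockwise X \<tau> g))"
      by (rule sum.reindex_bij_betw[OF bij_betw_blockwise[OF \<tau>], symmetric])
    also have "\<dots> = (\<Sum>g\<in>\<tau> \<rightarrow>\<^sub>E Y. \<Prod>y\<in>Y. b (\<Union>{C \<in> \<tau>. g C = y}))"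
      by (simp only: fibre_blockwise[OF \<tau>])
    finally show "?c \<tau> * (\<Sum>g\<in>\<tau> \<rightarrow>\<^sub>E Y. \<Prod>y\<in>Y. b (\<Union>{C \<in> \<tau>. g C = y})) =
        (\<Sum>f\<in>{f \<in> X \<rightarrow>\<^sub>E Y. \<forall>C\<in>\<tau>. constant_on C f}. ?c \<tau> * ?W f)"
      unfolding sum_distrib_left[symmetric] by simp
  qed
  also have "\<dots> = (\<Sum>f\<in>X \<rightarrow>\<^sub>E Y. \<Sum>\<tau> | \<tau> \<in> ?P \<and> (\<forall>C\<in>\<tau>. constant_on C f). ?c \<tau> * ?W f)"
    using sum.swap_restrict[OF finP finF, of "\<lambda>\<tau> f. ?c \<tau> * ?W f" "\<lambda>\<tau> f. \<forall>C\<in>\<tau>. constant_on C f"]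
    by simp
  also have "\<dots> = (\<Sum>f\<in>X \<rightarrow>\<^sub>E Y. if inj_on f X then ?W f else 0)"
    by (intro sum.cong) (simp_all add: sum_moebius_refining_kernel[OF X] flip: sum_distrib_right)
  also have "\<dots> = (\<Sum>f | f \<in> X \<rightarrow>\<^sub>E Y \<and> inj_on f X. ?W f)"
    using finF by (simp add: sum.inter_filter)
  also have "\<dots> = (\<Sum>f | f \<in> X \<rightarrow>\<^sub>E Y \<and> inj_on f X. \<Prod>x\<in>X. b {x})"
  proof (rule sum.cong[OF refl])
    fix f assume "f \<in> {f. f \<in> X \<rightarrow>\<^sub>E Y \<and> inj_on f X}"
    hence f: "f ` X \<subseteq> Y" "inj_on f X" by auto
    have "?W f = (\<Prod>y\<in>f ` X. b {x \<in> X. f x = y})"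
    proof (rule prod.mono_neutral_right[OF Y f(1)], rule ballI)
      fix y assume "y \<in> Y - f ` X"
      hence "{x \<in> X. f x = y} = {}" by auto
      thus "b {x \<in> X. f x = y} = 1" by (simp only: b)
    qed
    also have "\<dots> = (\<Prod>x\<in>X. b {x})"
    proof (subst prod.reindex[OF f(2)], rule prod.cong[OF refl])
      fix x assume "x \<in> X"
      hence "{z \<in> X. f z = f x} = {x}" using f(2) by (auto dest: inj_onD)
      thus "((\<lambda>y. b {z \<in> X. f z = y}) \<circ> f) x = b {x}" by simp
    qed
    finally show "?W f = (\<Prod>x\<in>X. b {x})" .
  qed
  also have "\<dots> = falling (of_nat (card Y)) (card X) * (\<Prod>x\<in>X. b {x})"
    using card_injections[OF X Y, where 'k = 'k] by simp
  finally show ?thesis .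
qed

section \<open>Monomials, umbrae and renaming\<close>

lemma mono_poly_0 [simp]: "mono_poly 0 = 1"
  by (simp add: mono_poly_def)

lemma mono_poly_add: "mono_poly (m + m') = mono_poly m * mono_poly m'"
  by (simp add: mono_poly_def mult_single)

lemma mono_poly_sum: "mono_poly (sum m I) = (\<Prod>i\<in>I. mono_poly (m i))"
  by (induction I rule: infinite_finite_induct) (simp_all add: mono_poly_add)

text \<open>
  Exponents are natural numbers and cannot cancel, so here the inclusion \<open>keys_add\<close> is an equality.
\<close>

lemma keys_add_nat: "Poly_Mapping.keys (m + m') = Poly_Mapping.keys m \<union> Poly_Mapping.keys m'"
  for m m' :: "'a umonom"
  by (auto simp: in_keys_iff lookup_add)

lemma keys_sum_nat:
  "finite I \<Longrightarrow> Poly_Mapping.keys (sum m I) = (\<Union>i\<in>I. Poly_Mapping.keys (m i))"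
  for m :: "'i \<Rightarrow> 'a umonom"
  by (induction I rule: finite_induct) (simp_all add: keys_add_nat)

lemma upoly_expand:
  "p = (\<Sum>m\<in>Poly_Mapping.keys p. cst (Poly_Mapping.lookup p m) * mono_poly m)"
proof (rule poly_mapping_eqI)
  fix m
  have "(\<Sum>m'\<in>Poly_Mapping.keys p. if m' = m then Poly_Mapping.lookup p m' else 0) =
      Poly_Mapping.lookup p m"
    by (simp add: in_keys_iff)
  thus "Poly_Mapping.lookup p m = Poly_Mapping.lookup
      (\<Sum>m\<in>Poly_Mapping.keys p. cst (Poly_Mapping.lookup p m) * mono_poly m) m"
    by (simp add: lookup_sum cst_def mono_poly_def mult_single lookup_single when_def)
qed

lemma umbrae_mono_poly: "umbrae (mono_poly m :: ('a, 'k::field_char_0) upoly) = Poly_Mapping.keys m"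
  by (simp add: umbrae_def mono_poly_def)

lemma umbrae_one: "umbrae (1 :: ('a, 'k::field_char_0) upoly) = {}"
  by (simp add: umbrae_def)

lemma umbrae_mult: "umbrae (p * q) \<subseteq> umbrae p \<union> umbrae q"
proof
  fix x assume "x \<in> umbrae (p * q)"
  then obtain l where l: "l \<in> Poly_Mapping.keys (p * q)" "x \<in> Poly_Mapping.keys l"
    unfolding umbrae_def by blast
  then obtain m m' where "l = m + m'" "m \<in> Poly_Mapping.keys p" "m' \<in> Poly_Mapping.keys q"
    using keys_mult[of p q] by blast
  thus "x \<in> umbrae p \<union> umbrae q"
    using l(2) unfolding umbrae_def by (auto simp: keys_add_nat)
qed

lemma umbrae_prod: "umbrae (prod p I) \<subseteq> (\<Union>i\<in>I. umbrae (p i))"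
proof (induction I rule: infinite_finite_induct)
  case (insert i I)
  show ?case using insert umbrae_mult[of "p i" "prod p I"] by auto
qed (simp_all add: umbrae_one)

lemma umbrae_power: "umbrae (p ^ k) \<subseteq> umbrae p"
proof (induction k)
  case (Suc k)
  thus ?case using umbrae_mult[of p "p ^ k"] by auto
qed (simp add: umbrae_one)

lemma umb_power: "umb x ^ k = mono_poly (Poly_Mapping.single x k)"
  by (induction k) (simp_all add: umb_def flip: mono_poly_add single_add)

lemma rename_mono_eq_sum:
  assumes "finite S" "Poly_Mapping.keys m \<subseteq> S"
  shows "rename_mono f m = (\<Sum>x\<in>S. Poly_Mapping.single (f x) (Poly_Mapping.lookup m x))"
  unfolding rename_mono_def using assms
  by (intro sum.mono_neutral_left) (auto simp: in_keys_iff)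

lemma rename_mono_0 [simp]: "rename_mono f 0 = 0"
  by (simp add: rename_mono_def)

lemma rename_mono_add: "rename_mono f (m + m') = rename_mono f m + rename_mono f m'"
proof -
  let ?S = "Poly_Mapping.keys m \<union> Poly_Mapping.keys m'"
  have "rename_mono f l = (\<Sum>x\<in>?S. Poly_Mapping.single (f x) (Poly_Mapping.lookup l x))"
    if "l \<in> {m, m', m + m'}" for l
    using that by (intro rename_mono_eq_sum) (auto simp: keys_add_nat)
  thus ?thesis by (simp add: lookup_add single_add sum.distrib)
qed

lemma rename_mono_sum: "rename_mono f (sum m I) = (\<Sum>i\<in>I. rename_mono f (m i))"
  by (induction I rule: infinite_finite_induct) (simp_all add: rename_mono_add)

lemma keys_rename_mono: "Poly_Mapping.keys (rename_mono f m) = f ` Poly_Mapping.keys m"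
  unfolding rename_mono_def by (subst keys_sum_nat) (auto simp: in_keys_iff split: if_splits)

lemma rename_poly_mono_poly:
  "rename_poly f (mono_poly m :: ('a, 'k::field_char_0) upoly) = mono_poly (rename_mono f m)"
  by (simp add: rename_poly_def mono_poly_def)

lemma dot_mset_image:
  assumes "finite J"
  shows "dot_mset copy n (image_mset s (mset_set J)) = (\<Prod>j\<in>J. dot copy n (mono_poly (s j)))"
  unfolding dot_mset_def image_prod_mset_multiplicity[symmetric]
  by (simp add: image_mset.compositionality o_def flip: prod_unfold_prod_mset)

section \<open>Falling factorials as polynomials\<close>

definition falling_poly :: "nat \<Rightarrow> 'k::field_char_0 poly" where
  "falling_poly m = (\<Prod>i<m. [:- of_nat i, 1:])"

lemma poly_falling_poly: "poly (falling_poly m) x = falling x m"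
  by (simp add: falling_poly_def falling_def poly_prod)

lemma falling_nonzero:
  assumes "m \<le> n"
  shows "falling (of_nat n) m \<noteq> (0 :: 'k::field_char_0)"
  using assms by (auto simp: falling_def)

text \<open>
  The left-hand side is \<open>E[(\<chi>)\<^sub>m]\<close>, as the moments of \<open>\<chi>\<close> of order 0 and 1 are 1 and all others vanish.
  For \<open>m > 0\<close>, \<open>(x)\<^sub>m\<close> is \<open>x\<close> times a polynomial with constant term \<open>(- 1)(- 2)\<dots>(- (m - 1))\<close>.
\<close>

lemma coeff_falling_poly:
  "coeff (falling_poly m) 0 + coeff (falling_poly m) 1 =
     (chi_dot_chi_moment m :: 'k::field_char_0)"
proof (cases m)
  case 0
  thus ?thesis by (simp add: falling_poly_def)
next
  case (Suc k)
  have "coeff (falling_poly (Suc k)) 0 = (0 :: 'k) \<and>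
      coeff (falling_poly (Suc k)) 1 = (chi_dot_chi_moment (Suc k) :: 'k)"
  proof (induction k)
    case 0
    show ?case by (simp add: falling_poly_def)
  next
    case (Suc k)
    have "falling_poly (Suc (Suc k)) = [:- of_nat (Suc k), 1:] * (falling_poly (Suc k) :: 'k poly)"
      by (simp add: falling_poly_def)
    thus ?case using Suc
      by (simp add: chi_dot_chi_moment_Suc[of "Suc k"] coeff_pCons del: of_nat_Suc)
  qed
  thus ?thesis by (simp add: Suc)
qed

section \<open>Evaluation of uncorrelated products\<close>

context umbral_calculus
begin

lemma E_0: "E 0 = 0"
  using E_scale[of 0 0] by simp

lemma E_sum: "E (sum p I) = (\<Sum>i\<in>I. E (p i))"
  by (induction I rule: infinite_finite_induct) (simp_all add: E_0 E_add)

definition moment :: "'a umonom \<Rightarrow> 'k" where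
  "moment m = E (mono_poly m)"

lemma moment_0 [simp]: "moment 0 = 1"
  by (simp add: moment_def E_one)

lemma E_expand: "E p = (\<Sum>m\<in>Poly_Mapping.keys p. Poly_Mapping.lookup p m * moment m)"
  by (subst upoly_expand) (simp only: E_sum E_scale moment_def)

lemma moment_add:
  assumes "Poly_Mapping.keys m \<inter> Poly_Mapping.keys m' = {}"
  shows "moment (m + m') = moment m * moment m'"
proof -
  have "moment (m + m') = (\<Prod>x\<in>Poly_Mapping.keys m \<union> Poly_Mapping.keys m'.
      E (umb x ^ Poly_Mapping.lookup (m + m') x))"
    by (simp add: moment_def E_mono keys_add_nat)
  also have "\<dots> = (\<Prod>x\<in>Poly_Mapping.keys m. E (umb x ^ Poly_Mapping.lookup (m + m') x)) *
      (\<Prod>x\<in>Poly_Mapping.keys m'. E (umb x ^ Poly_Mapping.lookup (m + m') x))"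
    using assms by (intro prod.union_disjoint) auto
  also have "\<dots> = moment m * moment m'"
    unfolding moment_def E_mono
  proof (intro arg_cong2[where f = "(*)"] prod.cong refl)
    fix x assume "x \<in> Poly_Mapping.keys m"
    hence "Poly_Mapping.lookup m' x = 0" using assms by (auto simp: in_keys_iff)
    thus "E (umb x ^ Poly_Mapping.lookup (m + m') x) = E (umb x ^ Poly_Mapping.lookup m x)"
      by (simp add: lookup_add)
  next
    fix x assume "x \<in> Poly_Mapping.keys m'"
    hence "Poly_Mapping.lookup m x = 0" using assms by (auto simp: in_keys_iff)
    thus "E (umb x ^ Poly_Mapping.lookup (m + m') x) = E (umb x ^ Poly_Mapping.lookup m' x)"
      by (simp add: lookup_add)
  qed
  finally show ?thesis .
qed

lemma E_mult_uncorrelated: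
  assumes "uncorrelated p q"
  shows "E (p * q) = E p * E q"
proof -
  have "E (p * q) = E (\<Sum>m\<in>Poly_Mapping.keys p. \<Sum>m'\<in>Poly_Mapping.keys q.
      cst (Poly_Mapping.lookup p m) * (cst (Poly_Mapping.lookup q m') * mono_poly (m + m')))"
    by (subst upoly_expand[of p], subst upoly_expand[of q])
      (simp add: sum_product mono_poly_add algebra_simps)
  also have "\<dots> = (\<Sum>m\<in>Poly_Mapping.keys p. \<Sum>m'\<in>Poly_Mapping.keys q.
      Poly_Mapping.lookup p m * (Poly_Mapping.lookup q m' * moment (m + m')))"
    by (simp only: E_sum E_scale moment_def)
  also have "\<dots> = (\<Sum>m\<in>Poly_Mapping.keys p. \<Sum>m'\<in>Poly_Mapping.keys q.
      (Poly_Mapping.lookup p m * moment m) * (Poly_Mapping.lookup q m' * moment m'))"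
  proof (intro sum.cong refl)
    fix m m' assume "m \<in> Poly_Mapping.keys p" "m' \<in> Poly_Mapping.keys q"
    hence "Poly_Mapping.keys m \<inter> Poly_Mapping.keys m' = {}"
      using assms unfolding uncorrelated_def umbrae_def by blast
    thus "Poly_Mapping.lookup p m * (Poly_Mapping.lookup q m' * moment (m + m')) =
        (Poly_Mapping.lookup p m * moment m) * (Poly_Mapping.lookup q m' * moment m')"
      by (simp add: moment_add)
  qed
  also have "\<dots> = E p * E q"
    by (simp only: sum_product E_expand[of p] E_expand[of q])
  finally show ?thesis .
qed

lemma E_prod_uncorrelated:
  assumes "finite I" and "\<And>i j. i \<in> I \<Longrightarrow> j \<in> I \<Longrightarrow> i \<noteq> j \<Longrightarrow> uncorrelated (p i) (p j)"
  shows "E (\<Prod>i\<in>I. p i) = (\<Prod>i\<in>I. E (p i))"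
  using assms
proof (induction I rule: finite_induct)
  case empty
  show ?case by (simp add: E_one)
next
  case (insert i I)
  have "umbrae (p i) \<inter> umbrae (p j) = {}" if "j \<in> I" for j
    using insert.prems[of i j] insert.hyps that unfolding uncorrelated_def by blast
  hence "uncorrelated (p i) (prod p I)"
    using umbrae_prod[of p I] unfolding uncorrelated_def by blast
  moreover have "E (prod p I) = (\<Prod>i\<in>I. E (p i))"
    by (rule insert.IH) (simp add: insert.prems)
  ultimately show ?case using insert.hyps by (simp add: E_mult_uncorrelated)
qed

lemma moment_rename_mono:
  assumes inj: "inj_on f (Poly_Mapping.keys m)"
    and sim: "\<And>x. x \<in> Poly_Mapping.keys m \<Longrightarrow> similar E (umb (f x)) (umb x)"
  shows "moment (rename_mono f m) = moment m"
proof -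
  have "mono_poly (rename_mono f m) =
      (\<Prod>x\<in>Poly_Mapping.keys m. umb (f x) ^ Poly_Mapping.lookup m x :: ('a, 'k) upoly)"
    by (simp add: rename_mono_def mono_poly_sum umb_power)
  hence "moment (rename_mono f m) =
      E (\<Prod>x\<in>Poly_Mapping.keys m. umb (f x) ^ Poly_Mapping.lookup m x)"
    by (simp add: moment_def)
  also have "\<dots> = (\<Prod>x\<in>Poly_Mapping.keys m. E (umb (f x) ^ Poly_Mapping.lookup m x))"
  proof (rule E_prod_uncorrelated)
    fix x y assume "x \<in> Poly_Mapping.keys m" "y \<in> Poly_Mapping.keys m" "x \<noteq> y"
    hence "f x \<noteq> f y" using inj by (auto dest: inj_onD)
    thus "uncorrelated (umb (f x) ^ Poly_Mapping.lookup m x :: ('a, 'k) upoly)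
        (umb (f y) ^ Poly_Mapping.lookup m y)"
      by (simp add: uncorrelated_def umb_power umbrae_mono_poly)
  qed simp
  also have "\<dots> = (\<Prod>x\<in>Poly_Mapping.keys m. E (umb x ^ Poly_Mapping.lookup m x))"
    using sim by (intro prod.cong) (simp_all add: similar_def)
  also have "\<dots> = moment m" by (simp add: moment_def E_mono)
  finally show ?thesis .
qed

section \<open>Power sums and cumulants\<close>

text \<open>
  Multiplying out, \<open>f\<close> selects the copy number for each factor. Factors with the same copy number
  combine to one renamed monomial, and those with different copy numbers share no umbra.
\<close>

lemma E_prod_dot:
  assumes X: "finite X"
  shows "E (\<Prod>i\<in>X. dot copy n (mono_poly (m i))) =
     (\<Sum>f\<in>X \<rightarrow>\<^sub>E {1..n}. \<Prod>k\<in>{1..n}. moment (\<Sum>i | i \<in> X \<and> f i = k. m i))"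
proof -
  have "(\<Prod>i\<in>X. dot copy n (mono_poly (m i)) :: ('a, 'k) upoly) =
      (\<Sum>f\<in>X \<rightarrow>\<^sub>E {1..n}. \<Prod>i\<in>X. mono_poly (rename_mono (copy (f i)) (m i)))"
    unfolding dot_def rename_poly_mono_poly using X by (rule prod_sum_PiE) simp
  hence "E (\<Prod>i\<in>X. dot copy n (mono_poly (m i))) =
      (\<Sum>f\<in>X \<rightarrow>\<^sub>E {1..n}. E (\<Prod>i\<in>X. mono_poly (rename_mono (copy (f i)) (m i))))"
    by (simp add: E_sum)
  also have "\<dots> = (\<Sum>f\<in>X \<rightarrow>\<^sub>E {1..n}. \<Prod>k\<in>{1..n}. moment (\<Sum>i | i \<in> X \<and> f i = k. m i))"
  proof (rule sum.cong[OF refl])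
    fix f assume "f \<in> X \<rightarrow>\<^sub>E {1..n}"
    hence f: "f ` X \<subseteq> {1..n}" by auto
    let ?M = "\<lambda>k. \<Sum>i | i \<in> X \<and> f i = k. m i"
    have "(\<Prod>i\<in>X. mono_poly (rename_mono (copy (f i)) (m i)) :: ('a, 'k) upoly) =
        (\<Prod>k\<in>{1..n}. \<Prod>i | i \<in> X \<and> f i = k. mono_poly (rename_mono (copy (f i)) (m i)))"
      by (rule prod.group[OF X _ f, symmetric]) simp
    also have "\<dots> = (\<Prod>k\<in>{1..n}. mono_poly (rename_mono (copy k) (?M k)))"
      by (rule prod.cong[OF refl]) (simp add: rename_mono_sum mono_poly_sum)
    finally have "E (\<Prod>i\<in>X. mono_poly (rename_mono (copy (f i)) (m i))) =
        E (\<Prod>k\<in>{1..n}. mono_poly (rename_mono (copy k) (?M k)))" by simp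
    also have "\<dots> = (\<Prod>k\<in>{1..n}. E (mono_poly (rename_mono (copy k) (?M k))))"
    proof (rule E_prod_uncorrelated)
      fix k l :: nat assume "k \<noteq> l"
      hence "copy k x \<noteq> copy l y" for x y
        using copy_distinct by (auto dest: injD[of _ "(k, x)" "(l, y)"])
      thus "uncorrelated (mono_poly (rename_mono (copy k) (?M k)) :: ('a, 'k) upoly)
          (mono_poly (rename_mono (copy l) (?M l)))"
        by (auto simp: uncorrelated_def umbrae_mono_poly keys_rename_mono)
    qed simp
    also have "\<dots> = (\<Prod>k\<in>{1..n}. moment (?M k))"
    proof (rule prod.cong[OF refl])
      fix k
      have "inj (copy k)"
        using copy_distinct by (auto intro!: injI dest: injD[of _ "(k, _)" "(k, _)"])
      hence "moment (rename_mono (copy k) (?M k)) = moment (?M k)"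
        by (intro moment_rename_mono copy_similar) (auto intro: inj_on_subset)
      thus "E (mono_poly (rename_mono (copy k) (?M k))) = moment (?M k)"
        by (simp add: moment_def)
    qed
    finally show "E (\<Prod>i\<in>X. mono_poly (rename_mono (copy (f i)) (m i))) =
        (\<Prod>k\<in>{1..n}. moment (?M k))" .
  qed
  finally show ?thesis .
qed

text \<open>
  The polynomial is unique because it is prescribed at all natural numbers, which are infinitely many
  points as the characteristic is zero.
\<close>

lemma dot_moment_poly_eq:
  assumes J: "finite J"
  shows "dot_moment_poly E copy (image_mset u (mset_set J)) =
     (\<Sum>\<pi> | partition_on J \<pi>. smult (\<Prod>B\<in>\<pi>. moment (\<Sum>j\<in>B. u j)) (falling_poly (card \<pi>)))"
    (is "_ = ?q")
  unfolding dot_moment_poly_def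
proof (rule the_equality)
  have "E (dot_mset copy n (image_mset u (mset_set J))) = poly ?q (of_nat n)" for n
  proof -
    have "E (dot_mset copy n (image_mset u (mset_set J))) =
        (\<Sum>f\<in>J \<rightarrow>\<^sub>E {1..n}. \<Prod>k\<in>{1..n}. moment (\<Sum>j\<in>{j \<in> J. f j = k}. u j))"
      unfolding dot_mset_image[OF J] by (rule E_prod_dot[OF J])
    also have "\<dots> = (\<Sum>\<pi> | partition_on J \<pi>.
        falling (of_nat (card {1..n})) (card \<pi>) * (\<Prod>B\<in>\<pi>. moment (\<Sum>j\<in>B. u j)))"
      by (rule sum_functions_by_kernel) (simp_all add: J)
    also have "\<dots> = poly ?q (of_nat n)"
      by (simp add: poly_sum poly_falling_poly mult.commute)
    finally show ?thesis .
  qed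
  thus q: "\<forall>n. poly ?q (of_nat n) = E (dot_mset copy n (image_mset u (mset_set J)))" by simp
  fix p assume "\<forall>n. poly p (of_nat n) = E (dot_mset copy n (image_mset u (mset_set J)))"
  hence "poly (p - ?q) (of_nat n) = 0" for n using q by simp
  hence "range (of_nat :: nat \<Rightarrow> 'k) \<subseteq> {x. poly (p - ?q) x = 0}" by auto
  moreover have "infinite (range (of_nat :: nat \<Rightarrow> 'k))"
    by (rule range_inj_infinite) (rule inj_of_nat)
  ultimately have "infinite {x. poly (p - ?q) x = 0}" using finite_subset by blast
  hence "p - ?q = 0" using poly_roots_finite[of "p - ?q"] by blast
  thus "p = ?q" by simp
qed

lemma E_poly_singleton_umbra:
  assumes "singleton_umbra E c"
  shows "E (poly (map_poly cst q) (umb c)) = coeff q 0 + coeff q 1"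
proof -
  have cst_0: "cst 0 = (0 :: ('a, 'k) upoly)" by (simp add: cst_def)
  have E_cst: "E (cst x) = x" for x using E_scale[of x 1] E_one by simp
  (* All moments of order at least 2 vanish, so only the part of q of degree at most 1 survives. *)
  have higher: "E (umb c ^ Suc (Suc k) * poly (map_poly cst p) (umb c)) = 0" for k p
  proof (induction p arbitrary: k)
    case 0
    show ?case by (simp add: E_0)
  next
    case (pCons a p)
    have "umb c ^ Suc (Suc k) * poly (map_poly cst (pCons a p)) (umb c) =
        cst a * umb c ^ Suc (Suc k) + umb c ^ Suc (Suc (Suc k)) * poly (map_poly cst p) (umb c)"
      by (simp add: map_poly_pCons cst_0 algebra_simps)
    moreover have "E (umb c ^ Suc (Suc k)) = 0"
      using assms unfolding singleton_umbra_def by (metis Suc_le_mono le0 numeral_2_eq_2)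
    ultimately show ?case using pCons.IH[of "Suc k"] by (simp only: E_add E_scale) simp
  qed
  obtain a b p where q: "q = pCons a (pCons b p)" by (metis pCons_cases)
  have "poly (map_poly cst q) (umb c) =
      cst a + (cst b * umb c + umb c ^ Suc (Suc 0) * poly (map_poly cst p) (umb c))"
    by (simp add: q map_poly_pCons cst_0 algebra_simps)
  thus ?thesis
    using assms by (simp only: E_add E_scale higher E_cst) (simp add: q singleton_umbra_def)
qed

lemma cumulant_eq:
  assumes J: "finite J" and c: "singleton_umbra E c"
  shows "cumulant E copy c (image_mset u (mset_set J)) =
     (\<Sum>\<pi> | partition_on J \<pi>.
        chi_dot_chi_moment (card \<pi>) * (\<Prod>B\<in>\<pi>. moment (\<Sum>j\<in>B. u j)))"
  unfolding cumulant_def dot_moment_poly_eq[OF J] E_poly_singleton_umbra[OF c]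
  by (simp add: coeff_sum algebra_simps flip: coeff_falling_poly sum.distrib)

text \<open>
  The moments of the labelled monomials are those of the unlabelled ones, as the labelling is
  injective on umbrae and replaces each umbra by a similar one.
\<close>

lemma cumulant_labelled_copy:
  assumes J: "finite J" and c: "singleton_umbra E c"
    and lab: "labelled_copy E (image_mset s (mset_set J)) M"
  shows "cumulant E copy c M =
     (\<Sum>\<pi> | partition_on J \<pi>.
        chi_dot_chi_moment (card \<pi>) * (\<Prod>B\<in>\<pi>. moment (\<Sum>j\<in>B. s j)))"
proof -
  let ?U = "image_mset s (mset_set J)"
  obtain f where inj: "inj_on f (mset_umbrae ?U)"
    and sim: "\<And>x. x \<in> mset_umbrae ?U \<Longrightarrow> similar E (umb (f x)) (umb x)"
    and M: "M = image_mset (rename_mono f) ?U"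
    using lab unfolding labelled_copy_def by blast
  have M': "M = image_mset (\<lambda>j. rename_mono f (s j)) (mset_set J)"
    unfolding M by (simp add: image_mset.compositionality o_def)
  have "moment (\<Sum>j\<in>B. rename_mono f (s j)) = moment (\<Sum>j\<in>B. s j)" if "B \<subseteq> J" for B
  proof -
    have "finite B" using that J finite_subset by blast
    hence "Poly_Mapping.keys (\<Sum>j\<in>B. s j) \<subseteq> mset_umbrae ?U"
      using that J by (auto simp: keys_sum_nat mset_umbrae_def)
    thus ?thesis unfolding rename_mono_sum[symmetric]
      using inj sim by (intro moment_rename_mono) (auto intro: inj_on_subset)
  qed
  moreover have "B \<subseteq> J" if "partition_on J \<pi>" "B \<in> \<pi>" for \<pi> B
    using that partition_onD1 by blast
  ultimately show ?thesis
    unfolding M' cumulant_eq[OF J c] by (intro sum.cong prod.cong arg_cong2[where f = "(*)"]) auto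
qed

text \<open>
  The fibre of \<open>g\<close> over \<open>k\<close> enters only through the set of all blocks \<open>B\<close> that it contains. Hence
  the right-hand side has the form of the inner sum in \<open>moebius_sum_over_partitions\<close>, with
  the set \<open>P\<close> of blocks as ground set.
\<close>

lemma E_dot_subdiv:
  assumes X: "finite X" and P: "partition_on X P" and \<tau>: "partition_on P \<tau>"
  shows "E (dot_subdiv copy n (subdivision s \<tau>)) =
     (\<Sum>g\<in>\<tau> \<rightarrow>\<^sub>E {1..n}. \<Prod>k\<in>{1..n}. moment (\<Sum>B\<in>\<Union>{C \<in> \<tau>. g C = k}. \<Sum>j\<in>B. s j))"
proof -
  have finP: "finite P" using X P by (rule finite_elements)
  have fin: "finite \<tau>" using finP \<tau> by (rule finite_elements)
  have finC: "finite C" if "C \<in> \<tau>" for C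
    using that finP partition_onD1[OF \<tau>] by (metis Sup_upper finite_subset)
  have "(\<Prod>C\<in>\<tau>. dot copy n (\<Prod>B\<in>C. \<Prod>j\<in>B. mono_poly (s j)) :: ('a, 'k) upoly) =
      (\<Prod>C\<in>\<tau>. dot copy n (mono_poly (\<Sum>B\<in>C. \<Sum>j\<in>B. s j)))"
    by (simp add: mono_poly_sum)
  hence "E (dot_subdiv copy n (subdivision s \<tau>)) = (\<Sum>g\<in>\<tau> \<rightarrow>\<^sub>E {1..n}. \<Prod>k\<in>{1..n}.
      moment (\<Sum>C | C \<in> \<tau> \<and> g C = k. \<Sum>B\<in>C. \<Sum>j\<in>B. s j))"
    unfolding dot_subdiv_subdivision[OF X P \<tau>] by (simp only: E_prod_dot[OF fin])
  moreover have "(\<Sum>B\<in>\<Union>{C \<in> \<tau>. g C = k}. \<Sum>j\<in>B. s j) =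
      (\<Sum>C | C \<in> \<tau> \<and> g C = k. \<Sum>B\<in>C. \<Sum>j\<in>B. s j)" for g :: "'b set set \<Rightarrow> nat" and k
    by (subst sum.Union_disjoint)
      (use finC partition_on_Int_eq_empty[OF \<tau>] in \<open>simp_all add: o_def\<close>)
  ultimately show ?thesis by simp
qed

lemma E_chi_dot_chi_power:
  "chi_dot_chi_umbra E x \<Longrightarrow> E (umb x ^ m) = chi_dot_chi_moment m"
  unfolding chi_dot_chi_umbra_def chi_dot_chi_moment_def
  by (cases "m = 0") (simp_all add: E_one)

lemma E_prod_chi_dot_chi_powers:
  assumes "finite I" "inj_on x I" "\<And>i. i \<in> I \<Longrightarrow> chi_dot_chi_umbra E (x i)"
  shows "E (\<Prod>i\<in>I. umb (x i) ^ e i) = (\<Prod>i\<in>I. chi_dot_chi_moment (e i))"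
proof -
  have "E (\<Prod>i\<in>I. umb (x i) ^ e i) = (\<Prod>i\<in>I. E (umb (x i) ^ e i))"
  proof (rule E_prod_uncorrelated[OF assms(1)])
    fix i j assume "i \<in> I" "j \<in> I" "i \<noteq> j"
    hence "x i \<noteq> x j" using assms(2) by (auto dest: inj_onD)
    thus "uncorrelated (umb (x i) ^ e i :: ('a, 'k) upoly) (umb (x j) ^ e j)"
      by (simp add: uncorrelated_def umb_power umbrae_mono_poly)
  qed
  thus ?thesis using assms(3) by (simp add: E_chi_dot_chi_power)
qed

end

section \<open>The multivariate polykay\<close>

lemma card_partition_le:
  assumes "finite X" "partition_on X P"
  shows "card P \<le> card X"
proof -
  have X_eq: "X = \<Union>P" using assms(2) partition_onD1 by blast
  have fin: "finite B" if "B \<in> P" for B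
    using that X_eq assms(1) by (metis Sup_upper finite_subset)
  have "card X = (\<Sum>B\<in>P. card B)"
    unfolding X_eq using partition_onD2[OF assms(2)] fin
    by (intro card_Union_disjoint) (auto simp: disjoint_def pairwise_def disjnt_def)
  moreover have "1 \<le> card B" if "B \<in> P" for B
    using that fin partition_on_block_nonempty[OF assms(2) that]
    by (metis One_nat_def Suc_leI card_gt_0_iff empty_iff)
  ultimately show ?thesis using sum_mono[of P "\<lambda>_. 1 :: nat" card] by simp
qed

theorem theorem6p3:
  fixes E :: "('a, 'k::field_char_0) upoly \<Rightarrow> 'k"
    and copy :: "nat \<Rightarrow> 'a \<Rightarrow> 'a"
    and r n :: nat
    and T U :: "nat \<Rightarrow> 'a umonom multiset"
    and J :: "nat \<Rightarrow> 'j set"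
    and s :: "'j \<Rightarrow> 'a umonom"
    and chi nu :: "nat \<Rightarrow> 'a"
    and om :: "'j set set set \<Rightarrow> 'j set set \<Rightarrow> 'a"
    and k :: "('a, 'k) upoly"
  assumes "umbral_calculus E copy"
    and "\<And>i i' \<mu> \<mu>'. i < r \<Longrightarrow> i' < r \<Longrightarrow> i \<noteq> i' \<Longrightarrow> \<mu> \<in># T i \<Longrightarrow> \<mu>' \<in># T i' \<Longrightarrow>
           uncorrelated (mono_poly \<mu> :: ('a, 'k) upoly) (mono_poly \<mu>')"
    and "\<And>i. i < r \<Longrightarrow> labelled_copy E (U i) (T i)"
    and "n > (\<Sum>i<r. size (T i))"
    and "\<And>i. i < r \<Longrightarrow> singleton_umbra E (chi i)"
    and "inj_on chi {..<r}"
    and "\<And>i i'. i < r \<Longrightarrow> i' < r \<Longrightarrow> chi i \<notin> mset_umbrae (T i')"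
    and "is_polykay E copy r chi T k"
    and "\<And>i. i < r \<Longrightarrow> finite (J i)"
    and "disjoint_family_on J {..<r}"
    and "\<And>i. i < r \<Longrightarrow> image_mset s (mset_set (J i)) = U i"
    and "\<And>i. i < r \<Longrightarrow> chi_dot_chi_umbra E (nu i)"
    and "inj_on nu {..<r}"
    and "\<And>\<pi> \<tau> C. \<pi> \<in> partition_tuples r J \<Longrightarrow> partition_on (all_blocks r \<pi>) \<tau> \<Longrightarrow> C \<in> \<tau> \<Longrightarrow>
           chi_dot_chi_umbra E (om \<tau> C)"
    and "\<And>\<pi> \<tau>. \<pi> \<in> partition_tuples r J \<Longrightarrow> partition_on (all_blocks r \<pi>) \<tau> \<Longrightarrow> inj_on (om \<tau>) \<tau>"
    and "\<And>\<pi> \<tau> i. \<pi> \<in> partition_tuples r J \<Longrightarrow> partition_on (all_blocks r \<pi>) \<tau> \<Longrightarrow> i < r \<Longrightarrow>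
           uncorrelated (umb (nu i) :: ('a, 'k) upoly) (dot_power (om \<tau>) \<tau>)"
    and "\<And>\<pi> \<tau> i. \<pi> \<in> partition_tuples r J \<Longrightarrow> partition_on (all_blocks r \<pi>) \<tau> \<Longrightarrow> i < r \<Longrightarrow>
           uncorrelated (umb (nu i) :: ('a, 'k) upoly) (dot_subdiv copy n (subdivision s \<tau>))"
    and "\<And>\<pi> \<tau>. \<pi> \<in> partition_tuples r J \<Longrightarrow> partition_on (all_blocks r \<pi>) \<tau> \<Longrightarrow>
           uncorrelated (dot_power (om \<tau>) \<tau> :: ('a, 'k) upoly) (dot_subdiv copy n (subdivision s \<tau>))"
  shows "E k = E (\<Sum>\<pi>\<in>partition_tuples r J.
           cst (1 / falling (of_nat n) (\<Sum>i<r. card (\<pi> i))) *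
           (\<Prod>i<r. umb (nu i) ^ card (\<pi> i)) *
           (\<Sum>\<tau> | partition_on (all_blocks r \<pi>) \<tau>.
              dot_power (om \<tau>) \<tau> * dot_subdiv copy n (subdivision s \<tau>)))"
proof -
  interpret umbral_calculus E copy by fact
  note T_copy = assms(3) and n_large = assms(4) and chi = assms(5) and polykay = assms(8)
    and finJ = assms(9) and disjJ = assms(10) and U = assms(11)
    and nu = assms(12) and nu_inj = assms(13) and om = assms(14) and om_inj = assms(15)
    and nu_om = assms(16) and nu_sub = assms(17) and om_sub = assms(18)
  let ?c = "chi_dot_chi_moment :: nat \<Rightarrow> 'k"
  let ?mu = "\<lambda>B. \<Sum>j\<in>B. s j"
  let ?Pi = "partition_tuples r J"

  have "E k = (\<Prod>i<r. \<Sum>\<pi> | partition_on (J i) \<pi>. ?c (card \<pi>) * (\<Prod>B\<in>\<pi>. moment (?mu B)))"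
  proof -
    have "cumulant E copy (chi i) (T i) =
        (\<Sum>\<pi> | partition_on (J i) \<pi>. ?c (card \<pi>) * (\<Prod>B\<in>\<pi>. moment (?mu B)))"
      if "i < r" for i
      using T_copy[OF that] by (intro cumulant_labelled_copy finJ chi that) (simp add: U that)
    thus ?thesis using polykay unfolding is_polykay_def by simp
  qed
  also have "\<dots> = (\<Sum>\<pi>\<in>?Pi. \<Prod>i<r. ?c (card (\<pi> i)) * (\<Prod>B\<in>\<pi> i. moment (?mu B)))"
    unfolding partition_tuples_def
    by (rule prod_sum_PiE) (simp_all add: finJ finitely_many_partition_on)
  also have "\<dots> = (\<Sum>\<pi>\<in>?Pi. E (cst (1 / falling (of_nat n) (\<Sum>i<r. card (\<pi> i))) *
      (\<Prod>i<r. umb (nu i) ^ card (\<pi> i)) *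
      (\<Sum>\<tau> | partition_on (all_blocks r \<pi>) \<tau>.
         dot_power (om \<tau>) \<tau> * dot_subdiv copy n (subdivision s \<tau>))))"
  proof (rule sum.cong[OF refl])
    fix \<pi> assume \<pi>: "\<pi> \<in> ?Pi"
    hence part: "partition_on (J i) (\<pi> i)" if "i < r" for i
      using that unfolding partition_tuples_def by auto
    have fin\<pi>: "finite (\<pi> i)" if "i < r" for i
      using finJ[OF that] part[OF that] by (rule finite_elements)
    have sub: "B \<subseteq> J i" if "i < r" "B \<in> \<pi> i" for i B
      using that part partition_onD1 by blast
    (* A common block would lie in two disjoint index sets, and blocks are nonempty. *)
    have disj\<pi>: "\<pi> i \<inter> \<pi> j = {}" if "i < r" "j < r" "i \<noteq> j" for i j
    proof (rule equals0I)
      fix B assume B: "B \<in> \<pi> i \<inter> \<pi> j"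
      then obtain x where "x \<in> B"
        using partition_on_block_nonempty[OF part[OF \<open>i < r\<close>]] by blast
      hence "x \<in> J i \<inter> J j" using B sub that by blast
      thus False using disjJ that unfolding disjoint_family_on_def by blast
    qed
    let ?P = "all_blocks r \<pi>"
    let ?X = "\<Union>i<r. J i"
    let ?Nu = "\<Prod>i<r. umb (nu i) ^ card (\<pi> i) :: ('a, 'k) upoly"
    let ?DP = "\<lambda>\<tau>. dot_power (om \<tau>) \<tau> :: ('a, 'k) upoly"
    let ?DS = "\<lambda>\<tau>. dot_subdiv copy n (subdivision s \<tau>) :: ('a, 'k) upoly"
    have finX: "finite ?X" using finJ by simp
    have partX: "partition_on ?X ?P"
    proof (rule partition_onI)
      show "\<Union>?P = ?X" using partition_onD1[OF part] unfolding all_blocks_def by auto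
      have "{} \<notin> \<pi> i" if "i < r" for i
        using partition_onD3[OF part[OF that]] .
      thus "{} \<notin> ?P" unfolding all_blocks_def by simp
      show "disjnt B B'" if B: "B \<in> ?P" "B' \<in> ?P" "B \<noteq> B'" for B B'
      proof -
        obtain i i' where i: "i < r" "B \<in> \<pi> i" "i' < r" "B' \<in> \<pi> i'"
          using B unfolding all_blocks_def by blast
        show ?thesis
        proof (cases "i = i'")
          case True
          thus ?thesis
            unfolding disjnt_def using i B(3) by (intro partition_on_Int_eq_empty[OF part]) simp_all
        next
          case False
          hence "J i \<inter> J i' = {}"
            using disjJ i(1,3) unfolding disjoint_family_on_def by simp
          thus ?thesis
            unfolding disjnt_def using sub[OF i(1,2)] sub[OF i(3,4)] by blast
        qed
      qed
    qed
    have finP: "finite ?P" using finX partX by (rule finite_elements)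
    have card_P: "card ?P = (\<Sum>i<r. card (\<pi> i))"
      unfolding all_blocks_def using fin\<pi> disj\<pi> by (intro card_UN_disjoint) auto
    have "size (T i) = card (J i)" if "i < r" for i
    proof -
      have "size (T i) = size (U i)"
        using T_copy[OF that] unfolding labelled_copy_def by (metis size_image_mset)
      thus ?thesis using U[OF that] finJ[OF that] by (metis size_image_mset size_mset_set)
    qed
    hence "(\<Sum>i<r. card (\<pi> i)) \<le> (\<Sum>i<r. size (T i))"
      using card_partition_le[OF finJ part] by (intro sum_mono) simp
    hence "card ?P \<le> n" using n_large card_P by simp
    hence fall: "falling (of_nat n) (card ?P) \<noteq> (0 :: 'k)" by (rule falling_nonzero)

    have E_Nu: "E ?Nu = (\<Prod>i<r. ?c (card (\<pi> i)))"
      using nu nu_inj by (intro E_prod_chi_dot_chi_powers) auto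
    have E_term: "E (?Nu * (?DP \<tau> * ?DS \<tau>)) = E ?Nu * ((\<Prod>C\<in>\<tau>. ?c (card C)) *
        (\<Sum>g\<in>\<tau> \<rightarrow>\<^sub>E {1..n}. \<Prod>k\<in>{1..n}. moment (\<Sum>B\<in>\<Union>{C \<in> \<tau>. g C = k}. ?mu B)))"
      if \<tau>: "partition_on ?P \<tau>" for \<tau>
    proof -
      have nu_dis: "umbrae (umb (nu i) :: ('a, 'k) upoly) \<inter> umbrae (?DP \<tau> * ?DS \<tau>) = {}"
        if "i < r" for i
        using nu_om[OF \<pi> \<tau> that] nu_sub[OF \<pi> \<tau> that] umbrae_mult[of "?DP \<tau>" "?DS \<tau>"]
        unfolding uncorrelated_def by blast
      have "umbrae ?Nu \<subseteq> (\<Union>i<r. umbrae (umb (nu i) ^ card (\<pi> i) :: ('a, 'k) upoly))"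
        by (rule umbrae_prod)
      also have "\<dots> \<subseteq> (\<Union>i<r. umbrae (umb (nu i) :: ('a, 'k) upoly))"
        by (intro UN_mono umbrae_power order_refl)
      finally have "uncorrelated ?Nu (?DP \<tau> * ?DS \<tau>)"
        unfolding uncorrelated_def using nu_dis by blast
      moreover have "E (?DP \<tau>) = (\<Prod>C\<in>\<tau>. ?c (card C))"
        unfolding dot_power_def using om[OF \<pi> \<tau>] om_inj[OF \<pi> \<tau>] finite_elements[OF finP \<tau>]
        by (intro E_prod_chi_dot_chi_powers)
      ultimately show ?thesis
        using om_sub[OF \<pi> \<tau>] E_dot_subdiv[OF finX partX \<tau>]
        by (simp only: E_mult_uncorrelated)
    qed
    have "(\<Sum>\<tau> | partition_on ?P \<tau>. E (?Nu * (?DP \<tau> * ?DS \<tau>))) =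
        E ?Nu * (\<Sum>\<tau> | partition_on ?P \<tau>. (\<Prod>C\<in>\<tau>. ?c (card C)) *
        (\<Sum>g\<in>\<tau> \<rightarrow>\<^sub>E {1..n}. \<Prod>k\<in>{1..n}. moment (\<Sum>B\<in>\<Union>{C \<in> \<tau>. g C = k}. ?mu B)))"
      unfolding sum_distrib_left[of "E ?Nu"] by (intro sum.cong refl E_term) simp
    also have "\<dots> = E ?Nu * (falling (of_nat n) (card ?P) * (\<Prod>B\<in>?P. moment (?mu B)))"
      using moebius_sum_over_partitions
        [OF finP, of "{1..n}" "\<lambda>S. moment (\<Sum>B\<in>S. ?mu B)"] by simp
    finally have sum_E: "(\<Sum>\<tau> | partition_on ?P \<tau>. E (?Nu * (?DP \<tau> * ?DS \<tau>))) =
        E ?Nu * (falling (of_nat n) (card ?P) * (\<Prod>B\<in>?P. moment (?mu B)))" .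
    have "E (cst (1 / falling (of_nat n) (\<Sum>i<r. card (\<pi> i))) * ?Nu *
        (\<Sum>\<tau> | partition_on ?P \<tau>. ?DP \<tau> * ?DS \<tau>)) =
        1 / falling (of_nat n) (card ?P) * (\<Sum>\<tau> | partition_on ?P \<tau>. E (?Nu * (?DP \<tau> * ?DS \<tau>)))"
      by (simp only: mult.assoc E_scale sum_distrib_left E_sum card_P)
    also have "\<dots> = E ?Nu * (\<Prod>B\<in>?P. moment (?mu B))"
      unfolding sum_E using fall by simp
    also have "(\<Prod>B\<in>?P. moment (?mu B)) = (\<Prod>i<r. \<Prod>B\<in>\<pi> i. moment (?mu B))"
      unfolding all_blocks_def using fin\<pi> disj\<pi> by (intro prod.UNION_disjoint) auto
    finally show "(\<Prod>i<r. ?c (card (\<pi> i)) * (\<Prod>B\<in>\<pi> i. moment (?mu B))) =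
        E (cst (1 / falling (of_nat n) (\<Sum>i<r. card (\<pi> i))) * ?Nu *
        (\<Sum>\<tau> | partition_on ?P \<tau>. ?DP \<tau> * ?DS \<tau>))"
      by (simp add: E_Nu prod.distrib)
  qed
  finally show ?thesis by (simp only: E_sum)
qed

end
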